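(* (Provably in $\mathbf{PA}$.) Let $\varepsilon_0>\alpha_0>\alpha_1>\alpha_2>\ldots$ be a slow primitive recursive descending sequence of ordinals, i.e., there is a constant $K$ such that $|\alpha_i|\leq K\cdot(i+1)$ for all $i$. Then there exists a primitive recursive descending sequence $\varepsilon_0>\beta_0>\beta_1>\beta_2>\ldots$ such that $\mathrm{ko}(\beta_r)\leq r+1$ for all $r$.
   Context: Ordinals below $\varepsilon_0$ (the least $\beta$ with $\omega^\beta=\beta$) are identified with their complete Cantor normal forms (Cantor normal form $\alpha=\omega^{\alpha_1}\cdot k_1+\ldots+\omega^{\alpha_n}\cdot k_n$ with $\alpha>\alpha_1>\ldots>\alpha_n$, $0<k_i<\omega$, applied recursively to the exponents), which can be coded in $\mathbf{PA}$. $|\alpha|$ denotes the length of $\alpha$ in complete Cantor normal form, defined recursively by $|\alpha|=\max\{|\alpha_1|,\ldots,|\alpha_n|,k_1,\ldots,k_n\}+1$. $\mathrm{ko}(\alpha)$ is the highest integer coefficient in the complete Cantor normal form of $\alpha$: $\mathrm{ko}(0)=0$ and $\mathrm{ko}(\alpha)=\max\{\mathrm{ko}(\alpha_1),\ldots,\mathrm{ko}(\alpha_n),k_1,\ldots,k_n\}$. *)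

theory Defs
  imports Main
begin

section \<open>Peano arithmetic\<close>

text \<open>
  First-order formulas over $0, S, +, \cdot, =$ with de Bruijn indices.
\<close>

datatype tm = Var nat | Zero | Succ tm | Add tm tm | Mul tm tm

datatype fm = Eq tm tm | Neg fm | Imp fm fm | All fm

primrec tsub :: "(nat \<Rightarrow> tm) \<Rightarrow> tm \<Rightarrow> tm" where
  "tsub \<sigma> (Var n) = \<sigma> n"
| "tsub \<sigma> Zero = Zero"
| "tsub \<sigma> (Succ t) = Succ (tsub \<sigma> t)"
| "tsub \<sigma> (Add s t) = Add (tsub \<sigma> s) (tsub \<sigma> t)"
| "tsub \<sigma> (Mul s t) = Mul (tsub \<sigma> s) (tsub \<sigma> t)"

definition up :: "(nat \<Rightarrow> tm) \<Rightarrow> nat \<Rightarrow> tm" where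
  "up \<sigma> = case_nat (Var 0) (\<lambda>n. tsub (\<lambda>k. Var (Suc k)) (\<sigma> n))"

primrec sub :: "(nat \<Rightarrow> tm) \<Rightarrow> fm \<Rightarrow> fm" where
  "sub \<sigma> (Eq s t) = Eq (tsub \<sigma> s) (tsub \<sigma> t)"
| "sub \<sigma> (Neg A) = Neg (sub \<sigma> A)"
| "sub \<sigma> (Imp A B) = Imp (sub \<sigma> A) (sub \<sigma> B)"
| "sub \<sigma> (All A) = All (sub (up \<sigma>) A)"

definition inst :: "fm \<Rightarrow> tm \<Rightarrow> fm" where
  "inst A t = sub (case_nat t Var) A"

definition lift :: "fm \<Rightarrow> fm" where
  "lift A = sub (\<lambda>n. Var (Suc n)) A"

text \<open>
  The usual Hilbert calculus for first-order logic with equality and the rule of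
  generalisation. Free variables of an axiom in \<open>T\<close> are thus implicitly universally
  quantified.
\<close>

inductive proves :: "fm set \<Rightarrow> fm \<Rightarrow> bool" (infix "\<turnstile>" 45) for T :: "fm set" where
  ax: "A \<in> T \<Longrightarrow> T \<turnstile> A"
| imp_K: "T \<turnstile> Imp A (Imp B A)"
| imp_S: "T \<turnstile> Imp (Imp A (Imp B C)) (Imp (Imp A B) (Imp A C))"
| contra: "T \<turnstile> Imp (Imp (Neg B) (Neg A)) (Imp (Imp (Neg B) A) B)"
| all_inst: "T \<turnstile> Imp (All A) (inst A t)"
| all_dist: "T \<turnstile> Imp (All (Imp (lift A) B)) (Imp A (All B))"
| eq_refl: "T \<turnstile> Eq t t"
| eq_subst: "T \<turnstile> Imp (Eq s t) (Imp (inst A s) (inst A t))"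
| mp: "T \<turnstile> Imp A B \<Longrightarrow> T \<turnstile> A \<Longrightarrow> T \<turnstile> B"
| gen: "T \<turnstile> A \<Longrightarrow> T \<turnstile> All A"

text \<open>
  In \<open>induction\<close>, the substitution replaces variable 0 by its successor and fixes all others.
\<close>

inductive_set PA :: "fm set" where
  Succ_neq_Zero: "Neg (Eq (Succ (Var 0)) Zero) \<in> PA"
| Succ_inject: "Imp (Eq (Succ (Var 0)) (Succ (Var 1))) (Eq (Var 0) (Var 1)) \<in> PA"
| Add_Zero: "Eq (Add (Var 0) Zero) (Var 0) \<in> PA"
| Add_Succ: "Eq (Add (Var 0) (Succ (Var 1))) (Succ (Add (Var 0) (Var 1))) \<in> PA"
| Mul_Zero: "Eq (Mul (Var 0) Zero) Zero \<in> PA"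
| Mul_Succ: "Eq (Mul (Var 0) (Succ (Var 1))) (Add (Mul (Var 0) (Var 1)) (Var 0)) \<in> PA"
| induction: "Imp (inst A Zero)
             (Imp (All (Imp A (sub (case_nat (Succ (Var 0)) (\<lambda>n. Var (Suc n))) A)))
               (All A)) \<in> PA"


section \<open>Notation for formulas\<close>

text \<open>
  To write formulas with named bound variables, terms and formulas are taken relative to the
  number \<open>d\<close> of quantifiers they stand under. The variable bound by the quantifier at depth
  \<open>d\<close> has, when it occurs at depth \<open>d'\<close>, the de Bruijn index \<open>d' - Suc d\<close>. The actual
  sentence is the value at depth 0.
\<close>

type_synonym dtm = "nat \<Rightarrow> tm"
type_synonym dfm = "nat \<Rightarrow> fm"

definition closed :: "dfm \<Rightarrow> fm" where
  "closed P = P 0"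

definition bvar :: "nat \<Rightarrow> dtm" where
  "bvar d = (\<lambda>d'. Var (d' - Suc d))"

definition dsucc :: "dtm \<Rightarrow> dtm" ("\<^bold>S") where
  "\<^bold>S s = (\<lambda>d. Succ (s d))"

definition dadd :: "dtm \<Rightarrow> dtm \<Rightarrow> dtm" (infixl "\<^bold>+" 65) where
  "s \<^bold>+ t = (\<lambda>d. Add (s d) (t d))"

definition dmul :: "dtm \<Rightarrow> dtm \<Rightarrow> dtm" (infixl "\<^bold>*" 70) where
  "s \<^bold>* t = (\<lambda>d. Mul (s d) (t d))"

primrec num :: "nat \<Rightarrow> dtm" where
  "num 0 = (\<lambda>d. Zero)"
| "num (Suc n) = \<^bold>S (num n)"

definition deq :: "dtm \<Rightarrow> dtm \<Rightarrow> dfm" (infix "\<^bold>=" 50) where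
  "(s \<^bold>= t) = (\<lambda>d. Eq (s d) (t d))"

definition dneg :: "dfm \<Rightarrow> dfm" ("\<^bold>\<not> _" [40] 40) where
  "(\<^bold>\<not> P) = (\<lambda>d. Neg (P d))"

definition dimp :: "dfm \<Rightarrow> dfm \<Rightarrow> dfm" (infixr "\<^bold>\<longrightarrow>" 25) where
  "(P \<^bold>\<longrightarrow> Q) = (\<lambda>d. Imp (P d) (Q d))"

definition dall :: "(dtm \<Rightarrow> dfm) \<Rightarrow> dfm" (binder "\<^bold>\<forall>" 10) where
  "dall P = (\<lambda>d. All (P (bvar d) (Suc d)))"

definition dconj :: "dfm \<Rightarrow> dfm \<Rightarrow> dfm" (infixr "\<^bold>\<and>" 35) where
  "(P \<^bold>\<and> Q) = (\<^bold>\<not> (P \<^bold>\<longrightarrow> \<^bold>\<not> Q))"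

definition ddisj :: "dfm \<Rightarrow> dfm \<Rightarrow> dfm" (infixr "\<^bold>\<or>" 30) where
  "(P \<^bold>\<or> Q) = (\<^bold>\<not> P \<^bold>\<longrightarrow> Q)"

definition dex :: "(dtm \<Rightarrow> dfm) \<Rightarrow> dfm" (binder "\<^bold>\<exists>" 10) where
  "dex P = (\<^bold>\<not> (\<^bold>\<forall>x. \<^bold>\<not> P x))"

definition dle :: "dtm \<Rightarrow> dtm \<Rightarrow> dfm" (infix "\<^bold>\<le>" 50) where
  "(s \<^bold>\<le> t) = (\<^bold>\<exists>x. s \<^bold>+ x \<^bold>= t)"

definition dless :: "dtm \<Rightarrow> dtm \<Rightarrow> dfm" (infix "\<^bold><" 50) where
  "(s \<^bold>< t) = (\<^bold>S s \<^bold>\<le> t)"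

definition is_max :: "dtm \<Rightarrow> dtm \<Rightarrow> dtm \<Rightarrow> dfm" where
  "is_max m s t = ((s \<^bold>\<le> t \<^bold>\<and> m \<^bold>= t) \<^bold>\<or> (t \<^bold>\<le> s \<^bold>\<and> m \<^bold>= s))"


section \<open>Coding in arithmetic\<close>

text \<open>
  The pairing \<open>(s + t)\<^sup>2 + s\<close> is injective, though not surjective, on pairs. It is monotone,
  so that components are bounded by the code. Lists are coded with \<open>num 0\<close> as the empty list.
\<close>

definition pair :: "dtm \<Rightarrow> dtm \<Rightarrow> dtm" where
  "pair s t = (s \<^bold>+ t) \<^bold>* (s \<^bold>+ t) \<^bold>+ s"

definition cons :: "dtm \<Rightarrow> dtm \<Rightarrow> dtm" where
  "cons s t = \<^bold>S (pair s t)"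

text \<open>
  Goedel's beta function: \<open>x\<close> is the remainder of \<open>c\<close> modulo \<open>1 + (i + 1) d\<close>, i.e.
  the \<open>i\<close>-th entry of the sequence coded by \<open>c\<close> and \<open>d\<close>.
\<close>

definition beta :: "dtm \<Rightarrow> dtm \<Rightarrow> dtm \<Rightarrow> dtm \<Rightarrow> dfm" where
  "beta c d i x =
     ((\<^bold>\<exists>q. c \<^bold>= q \<^bold>* \<^bold>S (\<^bold>S i \<^bold>* d) \<^bold>+ x) \<^bold>\<and> x \<^bold>< \<^bold>S (\<^bold>S i \<^bold>* d))"

text \<open>
  Finitary inductive definitions: \<open>R X x\<close> says that \<open>x\<close> follows by one rule from premises
  in \<open>X\<close>, and \<open>derivable R z\<close> says that there is a derivation of \<open>z\<close>, that is, a coded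
  finite sequence ending in \<open>z\<close> each of whose entries follows from earlier ones.
\<close>

definition derivable :: "((dtm \<Rightarrow> dfm) \<Rightarrow> dtm \<Rightarrow> dfm) \<Rightarrow> dtm \<Rightarrow> dfm" where
  "derivable R z =
     (\<^bold>\<exists>c. \<^bold>\<exists>d. \<^bold>\<exists>n. beta c d n z \<^bold>\<and>
       (\<^bold>\<forall>i. \<^bold>\<forall>x. i \<^bold>\<le> n \<^bold>\<and> beta c d i x \<^bold>\<longrightarrow>
          R (\<lambda>y. \<^bold>\<exists>j. j \<^bold>< i \<^bold>\<and> beta c d j y) x))"


section \<open>Ordinals below \<open>\<epsilon>\<^sub>0\<close> in arithmetic\<close>

text \<open>
  The ordinal 0 is coded by \<open>num 0\<close>, and \<open>ocons a k b\<close> codes $\omega^a \cdot k + b$, where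
  the exponents in \<open>b\<close> are smaller than \<open>a\<close> and \<open>k > 0\<close>. Hence a code is the list of pairs
  of exponent and coefficient in the complete Cantor normal form.
\<close>

definition ocons :: "dtm \<Rightarrow> dtm \<Rightarrow> dtm \<Rightarrow> dtm" where
  "ocons a k b = cons (pair a k) b"

text \<open>Lexicographic comparison of Cantor normal forms.\<close>

definition oless :: "dtm \<Rightarrow> dtm \<Rightarrow> dfm" where
  "oless u v =
     derivable (\<lambda>X x.
       (\<^bold>\<exists>a. \<^bold>\<exists>k. \<^bold>\<exists>b. x \<^bold>= pair (num 0) (ocons a k b)) \<^bold>\<or>
       (\<^bold>\<exists>a. \<^bold>\<exists>k. \<^bold>\<exists>b. \<^bold>\<exists>a'. \<^bold>\<exists>k'. \<^bold>\<exists>b'.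
          x \<^bold>= pair (ocons a k b) (ocons a' k' b') \<^bold>\<and>
          (X (pair a a') \<^bold>\<or>
           a \<^bold>= a' \<^bold>\<and> k \<^bold>< k' \<^bold>\<or>
           a \<^bold>= a' \<^bold>\<and> k \<^bold>= k' \<^bold>\<and> X (pair b b'))))
     (pair u v)"

definition is_ord :: "dtm \<Rightarrow> dfm" where
  "is_ord u =
     derivable (\<lambda>X x.
       x \<^bold>= num 0 \<^bold>\<or>
       (\<^bold>\<exists>a. \<^bold>\<exists>k. \<^bold>\<exists>b.
          x \<^bold>= ocons a k b \<^bold>\<and> num 0 \<^bold>< k \<^bold>\<and> X a \<^bold>\<and> X b \<^bold>\<and>
          (\<^bold>\<forall>a'. \<^bold>\<forall>k'. \<^bold>\<forall>b'. b \<^bold>= ocons a' k' b' \<^bold>\<longrightarrow> oless a' a)))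
     u"

text \<open>
  \<open>is_olen_max u m\<close> says that \<open>m\<close> is the maximum of all lengths of exponents of \<open>u\<close> and all
  coefficients of \<open>u\<close> (at top level), with the empty maximum being 0. The length of \<open>u\<close> is
  the successor of this number; in particular, 0 has length 1.
\<close>

definition is_olen_max :: "dtm \<Rightarrow> dtm \<Rightarrow> dfm" where
  "is_olen_max u m =
     derivable (\<lambda>X x.
       x \<^bold>= pair (num 0) (num 0) \<^bold>\<or>
       (\<^bold>\<exists>a. \<^bold>\<exists>k. \<^bold>\<exists>b. \<^bold>\<exists>p. \<^bold>\<exists>q. \<^bold>\<exists>r. \<^bold>\<exists>s.
          x \<^bold>= pair (ocons a k b) s \<^bold>\<and> X (pair a p) \<^bold>\<and> X (pair b q) \<^bold>\<and>
          is_max r (\<^bold>S p) k \<^bold>\<and> is_max s r q))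
     (pair u m)"

definition is_olen :: "dtm \<Rightarrow> dtm \<Rightarrow> dfm" where
  "is_olen u l = (\<^bold>\<exists>m. is_olen_max u m \<^bold>\<and> l \<^bold>= \<^bold>S m)"

definition is_ko :: "dtm \<Rightarrow> dtm \<Rightarrow> dfm" where
  "is_ko u m =
     derivable (\<lambda>X x.
       x \<^bold>= pair (num 0) (num 0) \<^bold>\<or>
       (\<^bold>\<exists>a. \<^bold>\<exists>k. \<^bold>\<exists>b. \<^bold>\<exists>p. \<^bold>\<exists>q. \<^bold>\<exists>r. \<^bold>\<exists>s.
          x \<^bold>= pair (ocons a k b) s \<^bold>\<and> X (pair a p) \<^bold>\<and> X (pair b q) \<^bold>\<and>
          is_max r p k \<^bold>\<and> is_max s r q))
     (pair u m)"


section \<open>Primitive recursive functions in arithmetic\<close>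

text \<open>
  Codes for the zero functions, the successor, the projections, composition of \<open>f\<close> with a
  list \<open>gs\<close> of functions, and primitive recursion
  $h(0,\vec x) = f(\vec x)$, $h(n+1,\vec x) = g(n, h(n,\vec x), \vec x)$.
\<close>

definition pr_zero :: dtm where "pr_zero = pair (num 0) (num 0)"
definition pr_succ :: dtm where "pr_succ = pair (num 1) (num 0)"
definition pr_proj :: "dtm \<Rightarrow> dtm" where "pr_proj i = pair (num 2) i"
definition pr_comp :: "dtm \<Rightarrow> dtm \<Rightarrow> dtm" where "pr_comp f gs = pair (num 3) (pair f gs)"
definition pr_rec :: "dtm \<Rightarrow> dtm \<Rightarrow> dtm" where "pr_rec f g = pair (num 4) (pair f g)"

text \<open>
  Two kinds of judgements are derived simultaneously: \<open>jfun n e\<close> (\<open>e\<close> is a code of an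
  \<open>n\<close>-ary function) and \<open>jfuns m n es\<close> (\<open>es\<close> is a list of \<open>m\<close> codes of \<open>n\<close>-ary functions).
\<close>

definition jfun :: "dtm \<Rightarrow> dtm \<Rightarrow> dtm" where
  "jfun n e = pair (num 0) (pair n e)"

definition jfuns :: "dtm \<Rightarrow> dtm \<Rightarrow> dtm \<Rightarrow> dtm" where
  "jfuns m n es = pair (num 1) (pair m (pair n es))"

definition is_pr :: "dtm \<Rightarrow> dtm \<Rightarrow> dfm" where
  "is_pr n e =
     derivable (\<lambda>X x.
       (\<^bold>\<exists>n. x \<^bold>= jfun n pr_zero) \<^bold>\<or>
       x \<^bold>= jfun (num 1) pr_succ \<^bold>\<or>
       (\<^bold>\<exists>n. \<^bold>\<exists>i. x \<^bold>= jfun n (pr_proj i) \<^bold>\<and> i \<^bold>< n) \<^bold>\<or>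
       (\<^bold>\<exists>m. \<^bold>\<exists>n. \<^bold>\<exists>f. \<^bold>\<exists>gs.
          x \<^bold>= jfun n (pr_comp f gs) \<^bold>\<and> X (jfun m f) \<^bold>\<and> X (jfuns m n gs)) \<^bold>\<or>
       (\<^bold>\<exists>n. \<^bold>\<exists>f. \<^bold>\<exists>g.
          x \<^bold>= jfun (\<^bold>S n) (pr_rec f g) \<^bold>\<and> X (jfun n f) \<^bold>\<and> X (jfun (\<^bold>S (\<^bold>S n)) g)) \<^bold>\<or>
       (\<^bold>\<exists>n. x \<^bold>= jfuns (num 0) n (num 0)) \<^bold>\<or>
       (\<^bold>\<exists>m. \<^bold>\<exists>n. \<^bold>\<exists>g. \<^bold>\<exists>gs.
          x \<^bold>= jfuns (\<^bold>S m) n (cons g gs) \<^bold>\<and> X (jfun n g) \<^bold>\<and> X (jfuns m n gs)))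
     (jfun n e)"

text \<open>
  Likewise for evaluation: \<open>jval e xs y\<close> (the function coded by \<open>e\<close> has value \<open>y\<close> at the
  argument list \<open>xs\<close>) and \<open>jvals es xs ys\<close> (the functions in the list \<open>es\<close> have the values
  \<open>ys\<close> at \<open>xs\<close>).
\<close>

definition jval :: "dtm \<Rightarrow> dtm \<Rightarrow> dtm \<Rightarrow> dtm" where
  "jval e xs y = pair (num 0) (pair e (pair xs y))"

definition jvals :: "dtm \<Rightarrow> dtm \<Rightarrow> dtm \<Rightarrow> dtm" where
  "jvals es xs ys = pair (num 1) (pair es (pair xs ys))"

definition pr_val :: "dtm \<Rightarrow> dtm \<Rightarrow> dtm \<Rightarrow> dfm" where
  "pr_val e xs y =
     derivable (\<lambda>X x.
       (\<^bold>\<exists>xs. x \<^bold>= jval pr_zero xs (num 0)) \<^bold>\<or>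
       (\<^bold>\<exists>n. x \<^bold>= jval pr_succ (cons n (num 0)) (\<^bold>S n)) \<^bold>\<or>
       (\<^bold>\<exists>n. \<^bold>\<exists>xs. x \<^bold>= jval (pr_proj (num 0)) (cons n xs) n) \<^bold>\<or>
       (\<^bold>\<exists>i. \<^bold>\<exists>n. \<^bold>\<exists>xs. \<^bold>\<exists>y.
          x \<^bold>= jval (pr_proj (\<^bold>S i)) (cons n xs) y \<^bold>\<and> X (jval (pr_proj i) xs y)) \<^bold>\<or>
       (\<^bold>\<exists>f. \<^bold>\<exists>gs. \<^bold>\<exists>xs. \<^bold>\<exists>ys. \<^bold>\<exists>z.
          x \<^bold>= jval (pr_comp f gs) xs z \<^bold>\<and> X (jvals gs xs ys) \<^bold>\<and> X (jval f ys z)) \<^bold>\<or>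
       (\<^bold>\<exists>f. \<^bold>\<exists>g. \<^bold>\<exists>xs. \<^bold>\<exists>y.
          x \<^bold>= jval (pr_rec f g) (cons (num 0) xs) y \<^bold>\<and> X (jval f xs y)) \<^bold>\<or>
       (\<^bold>\<exists>f. \<^bold>\<exists>g. \<^bold>\<exists>n. \<^bold>\<exists>xs. \<^bold>\<exists>y. \<^bold>\<exists>z.
          x \<^bold>= jval (pr_rec f g) (cons (\<^bold>S n) xs) z \<^bold>\<and>
          X (jval (pr_rec f g) (cons n xs) y) \<^bold>\<and> X (jval g (cons n (cons y xs)) z)) \<^bold>\<or>
       (\<^bold>\<exists>xs. x \<^bold>= jvals (num 0) xs (num 0)) \<^bold>\<or>
       (\<^bold>\<exists>g. \<^bold>\<exists>gs. \<^bold>\<exists>xs. \<^bold>\<exists>y. \<^bold>\<exists>ys.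
          x \<^bold>= jvals (cons g gs) xs (cons y ys) \<^bold>\<and> X (jval g xs y) \<^bold>\<and> X (jvals gs xs ys)))
     (jval e xs y)"


section \<open>Primitive recursive descending sequences in arithmetic\<close>

text \<open>
  Sequences are given by codes of unary primitive recursive functions. As the ordinals below
  \<open>\<epsilon>\<^sub>0\<close> are well-founded, no code of a descending sequence exists in the standard model, so
  that statements about such sequences have content only as statements about provability.
\<close>

definition nth_val :: "dtm \<Rightarrow> dtm \<Rightarrow> dtm \<Rightarrow> dfm" where
  "nth_val e i a = pr_val e (cons i (num 0)) a"

definition pr_descending :: "dtm \<Rightarrow> dfm" where
  "pr_descending e =
     (is_pr (num 1) e \<^bold>\<and>
      (\<^bold>\<forall>i. \<^bold>\<exists>a. \<^bold>\<exists>b. nth_val e i a \<^bold>\<and> nth_val e (\<^bold>S i) b \<^bold>\<and>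
         is_ord a \<^bold>\<and> is_ord b \<^bold>\<and> oless b a))"

definition slow :: "dtm \<Rightarrow> dfm" where
  "slow e =
     (\<^bold>\<exists>K. \<^bold>\<forall>i. \<^bold>\<exists>a. \<^bold>\<exists>l. nth_val e i a \<^bold>\<and> is_olen a l \<^bold>\<and> l \<^bold>\<le> K \<^bold>* \<^bold>S i)"

definition ko_bounded :: "dtm \<Rightarrow> dfm" where
  "ko_bounded e =
     (\<^bold>\<forall>r. \<^bold>\<exists>b. \<^bold>\<exists>m. nth_val e r b \<^bold>\<and> is_ko b m \<^bold>\<and> m \<^bold>\<le> \<^bold>S r)"

end

(*
  By completeness it suffices to show that every countable model of PA satisfies the sentence; the
  rest is an argument inside such a model, by induction over definable predicates.

  Let |alpha_i| <= K (i + 1), where K > 0. Then alpha_i is replaced by the block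
    omega^alpha_i * K > omega^alpha_i * (K - 1) > ... > omega^alpha_i * 1
  of length K, put at the positions K (i + 1), ..., K (i + 1) + K - 1, where all coefficients of its
  members are allowed. The K positions before the first block are filled with a descending
  sequence of towers w_(j+1) = omega^w_j, all of whose coefficients are 1, with
  w_0 = omega^w > omega^alpha_0 * K. No transitivity of the ordering is needed, and the new
  sequence is primitive recursive because blocks and towers are built by simple recursions.
*)

theory Submission
  imports Defs "HOL-Library.Countable_Set"
begin

section \<open>Substitution\<close>

text \<open>A formal derivation in the Hilbert calculus would have to carry the coding of sequences,
  recursive functions and ordinals; inside a model these are ordinary elements and predicates. The
  price is that induction holds only for definable predicates, so each induction comes with a proof
  of definability. Countability keeps this cheap: one environment enumerates the whole model, every
  parameter is the value of a free variable, and the formula itself is synthesised from the shape of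
  the predicate. The model is turned into a type to gain the theory of ordered semirings. A type
  cannot depend on the assumption that the sentence is unprovable, so it is built from a chosen
  model that refutes the sentence if any does. Everything may be nonstandard: K, the nesting depth
  of alpha_0 and the lengths of derivations. Hence towers, constants and case distinctions are codes
  evaluated in the model, and the starting tower is found by an induction in the model. The block of
  alpha_i starts at K (i + 1) because this number bounds both the length of alpha_i, hence its
  coefficients, and the factors 1, ..., K.\<close>

lemma tsub_tsub: "tsub \<sigma> (tsub \<tau> t) = tsub (\<lambda>n. tsub \<sigma> (\<tau> n)) t"
  by (induction t) auto

lemma up_comp: "up (\<lambda>n. tsub \<sigma> (\<tau> n)) = (\<lambda>n. tsub (up \<sigma>) (up \<tau> n))"
  by (rule ext) (auto simp: up_def tsub_tsub split: nat.split)

lemma sub_sub: "sub \<sigma> (sub \<tau> A) = sub (\<lambda>n. tsub \<sigma> (\<tau> n)) A"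
  by (induction A arbitrary: \<sigma> \<tau>) (simp_all add: tsub_tsub up_comp)

lemma tsub_Var: "tsub Var t = t"
  by (induction t) auto

lemma up_Var: "up Var = Var"
  by (rule ext) (auto simp: up_def split: nat.split)

lemma sub_Var: "sub Var A = A"
  by (induction A) (simp_all add: tsub_Var up_Var)

text \<open>Only finitely many variables occur in a term. Saying this through substitutions gives a
  notion of freshness without a definition of free variables.\<close>

lemma tsub_cong_bound: "\<exists>N. \<forall>\<sigma> \<tau>. (\<forall>n<N. \<sigma> n = \<tau> n) \<longrightarrow> tsub \<sigma> t = tsub \<tau> t"
proof (induction t)
  case (Var n)
  show ?case by (rule exI[of _ "Suc n"]) auto
next
  case (Add s t)
  then obtain N N' where "\<forall>\<sigma> \<tau>. (\<forall>n<N. \<sigma> n = \<tau> n) \<longrightarrow> tsub \<sigma> s = tsub \<tau> s"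
    "\<forall>\<sigma> \<tau>. (\<forall>n<N'. \<sigma> n = \<tau> n) \<longrightarrow> tsub \<sigma> t = tsub \<tau> t" by blast
  then show ?case by (intro exI[of _ "max N N'"]) (metis less_max_iff_disj tsub.simps(4))
next
  case (Mul s t)
  then obtain N N' where "\<forall>\<sigma> \<tau>. (\<forall>n<N. \<sigma> n = \<tau> n) \<longrightarrow> tsub \<sigma> s = tsub \<tau> s"
    "\<forall>\<sigma> \<tau>. (\<forall>n<N'. \<sigma> n = \<tau> n) \<longrightarrow> tsub \<sigma> t = tsub \<tau> t" by blast
  then show ?case by (intro exI[of _ "max N N'"]) (metis less_max_iff_disj tsub.simps(5))
qed auto

lemma sub_cong_bound: "\<exists>N. \<forall>\<sigma> \<tau>. (\<forall>n<N. \<sigma> n = \<tau> n) \<longrightarrow> sub \<sigma> A = sub \<tau> A"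
proof (induction A)
  case (Eq s t)
  obtain N N' where "\<forall>\<sigma> \<tau>. (\<forall>n<N. \<sigma> n = \<tau> n) \<longrightarrow> tsub \<sigma> s = tsub \<tau> s"
    "\<forall>\<sigma> \<tau>. (\<forall>n<N'. \<sigma> n = \<tau> n) \<longrightarrow> tsub \<sigma> t = tsub \<tau> t" using tsub_cong_bound by metis
  then show ?case by (intro exI[of _ "max N N'"]) (metis less_max_iff_disj sub.simps(1))
next
  case (Imp A B)
  then obtain N N' where "\<forall>\<sigma> \<tau>. (\<forall>n<N. \<sigma> n = \<tau> n) \<longrightarrow> sub \<sigma> A = sub \<tau> A"
    "\<forall>\<sigma> \<tau>. (\<forall>n<N'. \<sigma> n = \<tau> n) \<longrightarrow> sub \<sigma> B = sub \<tau> B" by blast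
  then show ?case by (intro exI[of _ "max N N'"]) (metis less_max_iff_disj sub.simps(3))
next
  case (All A)
  then obtain N where N: "\<forall>\<sigma> \<tau>. (\<forall>n<N. \<sigma> n = \<tau> n) \<longrightarrow> sub \<sigma> A = sub \<tau> A" by blast
  have "sub (up \<sigma>) A = sub (up \<tau>) A" if "\<forall>n<N. \<sigma> n = \<tau> n" for \<sigma> \<tau>
    using that by (intro N[rule_format]) (auto simp: up_def split: nat.split)
  then show ?case by (intro exI[of _ N]) auto
qed auto

lemma sub_inst: "sub \<sigma> (inst A t) = inst (sub (up \<sigma>) A) (tsub \<sigma> t)"
  unfolding inst_def sub_sub
  by (rule arg_cong[of _ _ "\<lambda>\<rho>. sub \<rho> A"], rule ext)
     (auto simp: up_def tsub_tsub tsub_Var split: nat.split)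

lemma sub_lift: "sub (up \<sigma>) (lift A) = lift (sub \<sigma> A)"
  unfolding lift_def sub_sub by (simp add: up_def)

text \<open>Terms do not count, so an instance \<open>inst C t\<close> has the size of
  \<open>C\<close>. The truth lemma for the term model recurses on this size because an instance is
  no subformula of \<open>All C\<close>.\<close>

primrec fsize :: "fm \<Rightarrow> nat" where
  "fsize (Eq s t) = 0"
| "fsize (Neg A) = Suc (fsize A)"
| "fsize (Imp A B) = Suc (fsize A + fsize B)"
| "fsize (All A) = Suc (fsize A)"

lemma fsize_sub: "fsize (sub \<sigma> A) = fsize A"
  by (induction A arbitrary: \<sigma>) auto

lemma proves_inst: "T \<turnstile> A \<Longrightarrow> T \<turnstile> inst A t"
  by (meson all_inst gen mp)

text \<open>The rule of generalisation binds variable 0 only. To generalise over another variable it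
  has to be renamed first, so provability must be stable under simultaneous substitution.\<close>

definition subst_closed :: "fm set \<Rightarrow> bool" where
  "subst_closed T \<longleftrightarrow> (\<forall>A\<in>T. \<forall>\<sigma>. T \<turnstile> sub \<sigma> A)"

lemma proves_sub:
  assumes T: "subst_closed T"
  shows "T \<turnstile> A \<Longrightarrow> T \<turnstile> sub \<sigma> A"
proof (induction arbitrary: \<sigma> rule: proves.induct)
  case (all_dist A B)
  then show ?case using proves.all_dist by (simp add: sub_lift)
next
  case (eq_subst s t A)
  then show ?case using proves.eq_subst by (simp add: sub_inst)
next
  case (all_inst A t)
  then show ?case using proves.all_inst by (simp add: sub_inst)
qed (use T in \<open>auto simp: subst_closed_def intro: proves.intros\<close>)

text \<open>Each single axiom has at most two free variables, so its substitution instances arise by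
  generalising and instantiating. An instance of induction is sent to another instance of the
  scheme.\<close>

lemma subst_closed_PA: "subst_closed PA"
  unfolding subst_closed_def
proof (intro ballI allI)
  fix A \<sigma>
  \<comment> \<open>Instantiation lowers the remaining indices. The first term is shifted in
    advance, so that the second instantiation restores it instead of replacing its variable
    0.\<close>
  have two: "PA \<turnstile> inst (inst A (tsub (\<lambda>n. Var (Suc n)) s)) t" if "A \<in> PA" for A s t
    using that by (intro proves_inst ax)
  have one: "PA \<turnstile> inst A s" if "A \<in> PA" for A s
    using that by (intro proves_inst ax)
  assume "A \<in> PA"
  then show "PA \<turnstile> sub \<sigma> A"
  proof cases
    case Succ_neq_Zero
    with one[OF PA.Succ_neq_Zero, of "\<sigma> 0"] show ?thesis by (simp add: inst_def)
  next
    case Succ_inject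
    with two[OF PA.Succ_inject, of "\<sigma> 0" "\<sigma> 1"] show ?thesis by (simp add: inst_def tsub_tsub tsub_Var)
  next
    case Add_Zero
    with one[OF PA.Add_Zero, of "\<sigma> 0"] show ?thesis by (simp add: inst_def)
  next
    case Add_Succ
    with two[OF PA.Add_Succ, of "\<sigma> 0" "\<sigma> 1"] show ?thesis by (simp add: inst_def tsub_tsub tsub_Var)
  next
    case Mul_Zero
    with one[OF PA.Mul_Zero, of "\<sigma> 0"] show ?thesis by (simp add: inst_def)
  next
    case Mul_Succ
    with two[OF PA.Mul_Succ, of "\<sigma> 0" "\<sigma> 1"] show ?thesis by (simp add: inst_def tsub_tsub tsub_Var)
  next
    case (induction B)
    \<comment> \<open>Replacing variable 0 by its successor commutes with substituting for the other
      variables, so the induction step of the substituted formula is the substituted induction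
      step.\<close>
    have "(\<lambda>n. tsub (up \<sigma>) (case_nat (Succ (Var 0)) (\<lambda>n. Var (Suc n)) n)) =
        (\<lambda>n. tsub (case_nat (Succ (Var 0)) (\<lambda>n. Var (Suc n))) (up \<sigma> n))"
      by (rule ext) (auto simp: up_def tsub_tsub split: nat.split)
    then show ?thesis
      using ax[OF PA.induction[of "sub (up \<sigma>) B"]] by (simp add: induction sub_inst sub_sub)
  qed
qed


section \<open>Completeness\<close>

primrec tval :: "'m \<Rightarrow> ('m \<Rightarrow> 'm) \<Rightarrow> ('m \<Rightarrow> 'm \<Rightarrow> 'm) \<Rightarrow> ('m \<Rightarrow> 'm \<Rightarrow> 'm) \<Rightarrow> (nat \<Rightarrow> 'm) \<Rightarrow> tm \<Rightarrow> 'm"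
where
  "tval z s a m \<rho> (Var n) = \<rho> n"
| "tval z s a m \<rho> Zero = z"
| "tval z s a m \<rho> (Succ t) = s (tval z s a m \<rho> t)"
| "tval z s a m \<rho> (Add t u) = a (tval z s a m \<rho> t) (tval z s a m \<rho> u)"
| "tval z s a m \<rho> (Mul t u) = m (tval z s a m \<rho> t) (tval z s a m \<rho> u)"

primrec sat :: "'m \<Rightarrow> ('m \<Rightarrow> 'm) \<Rightarrow> ('m \<Rightarrow> 'm \<Rightarrow> 'm) \<Rightarrow> ('m \<Rightarrow> 'm \<Rightarrow> 'm) \<Rightarrow> (nat \<Rightarrow> 'm) \<Rightarrow> fm \<Rightarrow> bool"
where
  "sat z s a m \<rho> (Eq t u) \<longleftrightarrow> tval z s a m \<rho> t = tval z s a m \<rho> u"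
| "sat z s a m \<rho> (Neg A) \<longleftrightarrow> \<not> sat z s a m \<rho> A"
| "sat z s a m \<rho> (Imp A B) \<longleftrightarrow> (sat z s a m \<rho> A \<longrightarrow> sat z s a m \<rho> B)"
| "sat z s a m \<rho> (All A) \<longleftrightarrow> (\<forall>x. sat z s a m (case_nat x \<rho>) A)"

lemma tval_tsub: "tval z s a m \<rho> (tsub \<sigma> t) = tval z s a m (\<lambda>n. tval z s a m \<rho> (\<sigma> n)) t"
  by (induction t) auto

lemma sat_sub: "sat z s a m \<rho> (sub \<sigma> A) \<longleftrightarrow> sat z s a m (\<lambda>n. tval z s a m \<rho> (\<sigma> n)) A"
proof (induction A arbitrary: \<rho> \<sigma>)
  case (All A)
  have "(\<lambda>n. tval z s a m (case_nat x \<rho>) (up \<sigma> n)) = case_nat x (\<lambda>n. tval z s a m \<rho> (\<sigma> n))" for x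
    by (rule ext) (auto simp: up_def tval_tsub split: nat.split)
  with All show ?case by simp
qed (auto simp: tval_tsub)

lemma sat_inst: "sat z s a m \<rho> (inst A t) \<longleftrightarrow> sat z s a m (case_nat (tval z s a m \<rho> t) \<rho>) A"
proof -
  have "(\<lambda>n. tval z s a m \<rho> (case_nat t Var n)) = case_nat (tval z s a m \<rho> t) \<rho>"
    by (rule ext) (auto split: nat.split)
  then show ?thesis by (simp add: inst_def sat_sub)
qed

section \<open>Derivability from open hypotheses\<close>

inductive conseq :: "fm set \<Rightarrow> fm set \<Rightarrow> fm \<Rightarrow> bool" for T \<Gamma> where
  prov: "T \<turnstile> A \<Longrightarrow> conseq T \<Gamma> A"
| hyp: "A \<in> \<Gamma> \<Longrightarrow> conseq T \<Gamma> A"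
| conseq_mp: "conseq T \<Gamma> (Imp A B) \<Longrightarrow> conseq T \<Gamma> A \<Longrightarrow> conseq T \<Gamma> B"

lemma conseq_mono: "conseq T \<Gamma> A \<Longrightarrow> \<Gamma> \<subseteq> \<Delta> \<Longrightarrow> conseq T \<Delta> A"
  by (induction rule: conseq.induct) (auto intro: conseq.intros)

lemma conseq_empty: "conseq T {} A \<Longrightarrow> T \<turnstile> A"
  by (induction rule: conseq.induct) (auto intro: mp)

lemma imp_refl: "T \<turnstile> Imp A A"
  by (meson imp_K imp_S mp)

text \<open>\<open>conseq\<close> has no rule of generalisation of its own: only theorems of
  \<open>T\<close> are generalised, and free variables of hypotheses act as constants. Therefore no
  proviso on variables appears.\<close>

lemma deduction: "conseq T (insert A \<Gamma>) B \<Longrightarrow> conseq T \<Gamma> (Imp A B)"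
proof (induction rule: conseq.induct)
  case (prov B)
  then show ?case by (meson conseq.prov imp_K mp)
next
  case (hyp B)
  show ?case
  proof (cases "B = A")
    case True
    then show ?thesis by (simp add: conseq.prov imp_refl)
  next
    case False
    with hyp show ?thesis by (meson conseq.intros imp_K insertE)
  qed
next
  case (conseq_mp B C)
  then show ?case by (meson conseq.intros imp_S)
qed

lemma conseq_compact: "conseq T \<Gamma> A \<Longrightarrow> \<exists>\<Delta>. finite \<Delta> \<and> \<Delta> \<subseteq> \<Gamma> \<and> conseq T \<Delta> A"
proof (induction rule: conseq.induct)
  case (prov A)
  then show ?case by (auto intro!: exI[of _ "{}"] conseq.prov)
next
  case (hyp A)
  then show ?case by (auto intro!: exI[of _ "{A}"] conseq.hyp)
next
  case (conseq_mp A B)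
  then obtain \<Delta> \<Delta>' where "finite \<Delta>" "\<Delta> \<subseteq> \<Gamma>" "conseq T \<Delta> (Imp A B)"
    "finite \<Delta>'" "\<Delta>' \<subseteq> \<Gamma>" "conseq T \<Delta>' A" by blast
  then show ?case
    by (intro exI[of _ "\<Delta> \<union> \<Delta>'"]) (auto intro: conseq.conseq_mp conseq_mono)
qed

definition consistent :: "fm set \<Rightarrow> fm set \<Rightarrow> bool" where
  "consistent T \<Gamma> \<longleftrightarrow> \<not> (\<exists>A. conseq T \<Gamma> A \<and> conseq T \<Gamma> (Neg A))"

lemma by_contradiction:
  assumes "\<not> consistent T (insert (Neg A) \<Gamma>)"
  shows "conseq T \<Gamma> A"
  using assms deduction contra unfolding consistent_def by (meson conseq.intros)

lemma ex_falso: "conseq T \<Gamma> A \<Longrightarrow> conseq T \<Gamma> (Neg A) \<Longrightarrow> conseq T \<Gamma> B"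
  by (meson consistent_def by_contradiction conseq_mono subset_insertI)

lemma neg_intro:
  assumes "\<not> consistent T (insert A \<Gamma>)"
  shows "conseq T \<Gamma> (Neg A)"
proof (rule by_contradiction)
  let ?\<Delta> = "insert (Neg (Neg A)) \<Gamma>"
  have A: "conseq T ?\<Delta> A"
  proof (rule by_contradiction)
    show "\<not> consistent T (insert (Neg A) ?\<Delta>)"
      unfolding consistent_def by (auto intro!: exI[of _ "Neg A"] conseq.hyp)
  qed
  obtain B where "conseq T (insert A \<Gamma>) B" "conseq T (insert A \<Gamma>) (Neg B)"
    using assms unfolding consistent_def by blast
  then have "conseq T ?\<Delta> (Imp A B)" "conseq T ?\<Delta> (Imp A (Neg B))"
    using deduction conseq_mono subset_insertI by metis+
  with A show "\<not> consistent T ?\<Delta>"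
    unfolding consistent_def by (meson conseq.intros)
qed

text \<open>Renaming \<open>y\<close> to variable 0 and shifting all others turns the hypotheses
  into their lifts and \<open>inst A (Var y)\<close> into \<open>A\<close>. The finitely many
  hypotheses are then moved into the formula by the deduction lemma, the resulting theorem is
  generalised, and \<open>all_dist\<close> takes them out of the quantifier again.\<close>

lemma generalize:
  assumes T: "subst_closed T"
    and y: "\<forall>B\<in>insert (All A) \<Gamma>. \<forall>\<sigma> \<tau>. (\<forall>n<y. \<sigma> n = \<tau> n) \<longrightarrow> sub \<sigma> B = sub \<tau> B"
    and fin: "finite \<Gamma>" and A: "conseq T \<Gamma> (inst A (Var y))"
  shows "conseq T \<Gamma> (All A)"
proof -
  define \<tau> where "\<tau> n = (if n = y then Var 0 else Var (Suc n))" for n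
  have *: "conseq T (lift ` \<Gamma>) (sub \<tau> C)" if "conseq T \<Gamma> C" for C
    using that
  proof (induction rule: conseq.induct)
    case (prov C)
    then show ?case by (intro conseq.prov proves_sub[OF T])
  next
    case (hyp C)
    then have "sub \<tau> C = lift C"
      unfolding lift_def by (intro y[rule_format, of C \<tau>]) (simp_all add: \<tau>_def)
    then show ?case using hyp by (auto intro: conseq.hyp)
  next
    case (conseq_mp C D)
    then show ?case by (metis conseq.conseq_mp sub.simps(3))
  qed
  have "sub \<tau> (inst A (Var y)) = A"
  proof -
    have "sub \<tau> (inst A (Var y)) = inst (sub (up \<tau>) A) (Var 0)"
      by (simp add: sub_inst \<tau>_def)
    also have "sub (up \<tau>) A = sub (up (\<lambda>n. Var (Suc n))) A"
      using y[rule_format, of "All A" \<tau> "\<lambda>n. Var (Suc n)"] by (simp add: \<tau>_def)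
    also have "inst \<dots> (Var 0) = sub Var A"
      unfolding inst_def sub_sub
      by (rule arg_cong[of _ _ "\<lambda>\<rho>. sub \<rho> A"], rule ext) (auto simp: up_def split: nat.split)
    finally show ?thesis by (simp add: sub_Var)
  qed
  with *[OF A] have "conseq T (lift ` \<Gamma>) A" by simp
  moreover have "conseq T (lift ` \<Gamma>) C \<Longrightarrow> conseq T \<Gamma> (All C)" if "finite \<Gamma>" for C \<Gamma>
    using that
  proof (induction \<Gamma> arbitrary: C rule: finite_induct)
    case empty
    then show ?case by (auto intro: conseq.prov gen dest: conseq_empty)
  next
    case (insert B \<Gamma>)
    then have "conseq T \<Gamma> (All (Imp (lift B) C))" by (simp add: deduction)
    then have "conseq T \<Gamma> (Imp B (All C))" by (rule conseq_mp[OF prov[OF all_dist]])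
    then have "conseq T (insert B \<Gamma>) (Imp B (All C))" by (rule conseq_mono) blast
    then show ?case by (rule conseq_mp) (simp add: hyp)
  qed
  ultimately show ?thesis using fin by blast
qed

section \<open>Henkin sets and the term model\<close>

instance tm :: countable by countable_datatype
instance fm :: countable by countable_datatype

text \<open>Variables serve as witnesses in place of new constants: a finite set of formulas always
  leaves fresh ones.\<close>

definition henkin :: "fm set \<Rightarrow> fm set \<Rightarrow> bool" where
  "henkin T \<Gamma> \<longleftrightarrow> consistent T \<Gamma> \<and> (\<forall>A. conseq T \<Gamma> A \<longrightarrow> A \<in> \<Gamma>) \<and> (\<forall>A. A \<in> \<Gamma> \<or> Neg A \<in> \<Gamma>) \<and>
     (\<forall>A. Neg (All A) \<in> \<Gamma> \<longrightarrow> (\<exists>y. Neg (inst A (Var y)) \<in> \<Gamma>))"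

text \<open>Deciding a formula and supplying its witness happen in one step, while the set is still
  finite. If the witness caused an inconsistency, \<open>inst B (Var y)\<close> would follow for a
  fresh \<open>y\<close>, hence \<open>All B\<close>, against the formula just added.\<close>

lemma henkin_step:
  assumes T: "subst_closed T"
    and G: "finite \<Gamma>" "consistent T \<Gamma>"
  shows "\<exists>\<Delta>. finite \<Delta> \<and> consistent T \<Delta> \<and> \<Gamma> \<subseteq> \<Delta> \<and> (A \<in> \<Delta> \<or> conseq T \<Delta> (Neg A)) \<and>
    (\<forall>B. A \<in> \<Delta> \<and> A = Neg (All B) \<longrightarrow> (\<exists>y. Neg (inst B (Var y)) \<in> \<Delta>))"
proof (cases "consistent T (insert A \<Gamma>)")
  case False
  then have "conseq T \<Gamma> (Neg A)" by (rule neg_intro)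
  moreover from this G(2) have "A \<notin> \<Gamma>" unfolding consistent_def by (meson conseq.hyp)
  ultimately show ?thesis using G by (intro exI[of _ \<Gamma>]) auto
next
  case cons: True
  show ?thesis
  proof (cases "\<exists>B. A = Neg (All B)")
    case False
    then show ?thesis using G cons by (intro exI[of _ "insert A \<Gamma>"]) auto
  next
    case True
    then obtain B where B: "A = Neg (All B)" by blast
    obtain N where N: "\<And>C \<sigma> \<tau>. \<forall>n<N C. \<sigma> n = \<tau> n \<Longrightarrow> sub \<sigma> C = sub \<tau> C"
      using sub_cong_bound by metis
    define y where "y = Max (N ` insert (All B) (insert A \<Gamma>))"
    have y: "N C \<le> y" if "C \<in> insert (All B) (insert A \<Gamma>)" for C
      unfolding y_def using that G(1) by (intro Max_ge) auto
    have "consistent T (insert (Neg (inst B (Var y))) (insert A \<Gamma>))"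
    proof (rule ccontr)
      assume "\<not> ?thesis"
      then have "conseq T (insert A \<Gamma>) (inst B (Var y))" by (rule by_contradiction)
      then have "conseq T (insert A \<Gamma>) (All B)"
        using G(1)
      proof (intro generalize[OF T, of _ _ y] ballI allI impI)
        fix C \<sigma> \<tau>
        assume "C \<in> insert (All B) (insert A \<Gamma>)" "\<forall>n<y. \<sigma> n = (\<tau> n :: tm)"
        then show "sub \<sigma> C = sub \<tau> C" using y by (intro N) (meson less_le_trans)
      qed simp_all
      with cons show False unfolding consistent_def B by (meson conseq.hyp insertI1)
    qed
    then show ?thesis
      using G B by (intro exI[of _ "insert (Neg (inst B (Var y))) (insert A \<Gamma>)"]) auto
  qed
qed

text \<open>Stage \<open>n\<close> decides the formula with number \<open>n\<close> in an
  enumeration of all formulas. Consistency survives the union because a derivation uses finitely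
  many hypotheses.\<close>

lemma henkin_extension:
  assumes T: "subst_closed T" and A: "\<not> T \<turnstile> A"
  shows "\<exists>\<Gamma>. henkin T \<Gamma> \<and> Neg A \<in> \<Gamma>"
proof -
  let ?P = "\<lambda>n \<Delta>. finite \<Delta> \<and> consistent T \<Delta> \<and> Neg A \<in> \<Delta>"
  let ?Q = "\<lambda>n \<Gamma> \<Delta>. \<Gamma> \<subseteq> \<Delta> \<and> (from_nat n \<in> \<Delta> \<or> conseq T \<Delta> (Neg (from_nat n))) \<and>
    (\<forall>B. from_nat n \<in> \<Delta> \<and> from_nat n = Neg (All B) \<longrightarrow> (\<exists>y. Neg (inst B (Var y)) \<in> \<Delta>))"
  have "\<exists>f. \<forall>n. ?P n (f n) \<and> ?Q n (f n) (f (Suc n))"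
  proof (rule dependent_nat_choice)
    have "consistent T {Neg A}" using A by_contradiction conseq_empty by blast
    then show "\<exists>\<Delta>. ?P 0 \<Delta>" by (intro exI[of _ "{Neg A}"]) auto
  next
    fix \<Gamma> n
    assume "?P n \<Gamma>"
    then show "\<exists>\<Delta>. ?P (Suc n) \<Delta> \<and> ?Q n \<Gamma> \<Delta>"
      using henkin_step[OF T, of \<Gamma> "from_nat n"] by blast
  qed
  then obtain f where f: "\<And>n. ?P n (f n)" "\<And>n. ?Q n (f n) (f (Suc n))" by blast
  define \<Gamma> where "\<Gamma> = (\<Union>n. f n)"
  have mono: "m \<le> n \<Longrightarrow> f m \<subseteq> f n" for m n
    by (rule lift_Suc_mono_le[of f]) (use f(2) in blast)+
  have sub\<Gamma>: "f n \<subseteq> \<Gamma>" for n unfolding \<Gamma>_def by blast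
  have stage: "\<exists>n. conseq T (f n) B" if B: "conseq T \<Gamma> B" for B
  proof -
    obtain \<Delta> where \<Delta>: "finite \<Delta>" "\<Delta> \<subseteq> \<Gamma>" "conseq T \<Delta> B" using conseq_compact[OF B] by blast
    from \<Delta>(1,2) have "\<exists>n. \<Delta> \<subseteq> f n"
    proof (induction rule: finite_induct)
      case (insert C \<Delta>)
      obtain n where n: "\<Delta> \<subseteq> f n" using insert by blast
      obtain k where k: "C \<in> f k" using insert.prems unfolding \<Gamma>_def by blast
      have "f n \<subseteq> f (max n k)" "f k \<subseteq> f (max n k)" by (simp_all add: mono)
      with n k show ?case by blast
    qed simp
    with \<Delta>(3) show ?thesis by (blast intro: conseq_mono)
  qed
  have con: "consistent T \<Gamma>"
    unfolding consistent_def
  proof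
    assume "\<exists>B. conseq T \<Gamma> B \<and> conseq T \<Gamma> (Neg B)"
    then obtain B n k where B: "conseq T (f n) B" "conseq T (f k) (Neg B)" using stage by blast
    have "conseq T (f (max n k)) B" "conseq T (f (max n k)) (Neg B)"
      by (rule conseq_mono[OF B(1)], simp add: mono) (rule conseq_mono[OF B(2)], simp add: mono)
    then show False using f(1) unfolding consistent_def by blast
  qed
  have dec: "B \<in> \<Gamma> \<or> conseq T \<Gamma> (Neg B)" for B
    using f(2)[of "to_nat B"] sub\<Gamma>[of "Suc (to_nat B)"]
    unfolding from_nat_to_nat by (meson conseq_mono subsetD)
  have ded: "B \<in> \<Gamma>" if "conseq T \<Gamma> B" for B
    using dec con that unfolding consistent_def by blast
  have wit: "\<exists>y. Neg (inst B (Var y)) \<in> \<Gamma>" if "Neg (All B) \<in> \<Gamma>" for B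
  proof -
    \<comment> \<open>At the stage of its number the formula was either added together with a
      witness or refuted. A refutation would persist in the union and contradict its
      consistency.\<close>
    let ?n = "to_nat (Neg (All B))"
    have "\<not> conseq T (f (Suc ?n)) (Neg (Neg (All B)))"
      using con that conseq_mono[OF _ sub\<Gamma>] unfolding consistent_def by (meson conseq.hyp)
    then show ?thesis using f(2)[of ?n] sub\<Gamma>[of "Suc ?n"]
      unfolding from_nat_to_nat by blast
  qed
  have "Neg A \<in> \<Gamma>" using f(1)[of 0] sub\<Gamma>[of 0] by blast
  then show ?thesis using con ded dec wit unfolding henkin_def by blast
qed

text \<open>The term model modulo the equations in a Henkin set, with its classes numbered by
  natural numbers. The fixed carrier \<open>nat\<close> allows the model to be chosen and made into
  a type later.\<close>

lemma PA_countermodel: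
  assumes "\<not> PA \<turnstile> A"
  shows "\<exists>(z :: nat) s a m e. (\<forall>B\<in>PA. \<forall>\<rho>. sat z s a m \<rho> B) \<and> \<not> sat z s a m e A"
proof -
  obtain \<Gamma> where \<Gamma>: "henkin PA \<Gamma>" and A: "Neg A \<in> \<Gamma>"
    using henkin_extension[OF subst_closed_PA assms] by blast
  have mem: "B \<in> \<Gamma>" if "conseq PA \<Gamma> B" for B
    using \<Gamma> that unfolding henkin_def by blast
  have prov: "B \<in> \<Gamma>" if "PA \<turnstile> B" for B
    by (intro mem conseq.prov that)
  have ded: "C \<in> \<Gamma>" if "PA \<turnstile> Imp B C" "B \<in> \<Gamma>" for B C
    by (rule mem, rule conseq_mp[OF conseq.prov[OF that(1)] conseq.hyp[OF that(2)]])
  have neg: "Neg B \<in> \<Gamma> \<longleftrightarrow> B \<notin> \<Gamma>" for B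
    using \<Gamma> conseq.hyp[of _ \<Gamma>] unfolding henkin_def consistent_def by blast
  have imp: "Imp B C \<in> \<Gamma> \<longleftrightarrow> (B \<in> \<Gamma> \<longrightarrow> C \<in> \<Gamma>)" for B C
  proof
    assume BC: "Imp B C \<in> \<Gamma>"
    show "B \<in> \<Gamma> \<longrightarrow> C \<in> \<Gamma>"
    proof
      assume B: "B \<in> \<Gamma>"
      show "C \<in> \<Gamma>" by (rule mem, rule conseq_mp[OF conseq.hyp[OF BC] conseq.hyp[OF B]])
    qed
  next
    assume "B \<in> \<Gamma> \<longrightarrow> C \<in> \<Gamma>"
    then consider "C \<in> \<Gamma>" | "Neg B \<in> \<Gamma>" using neg by blast
    then show "Imp B C \<in> \<Gamma>"
    proof cases
      case 1
      show ?thesis by (rule ded[OF imp_K 1])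
    next
      case 2
      have "conseq PA (insert B \<Gamma>) C"
        by (rule ex_falso[of _ _ B]) (use 2 in \<open>auto intro: conseq.hyp\<close>)
      then show ?thesis by (intro mem deduction)
    qed
  qed
  have all: "All B \<in> \<Gamma> \<longleftrightarrow> (\<forall>t. inst B t \<in> \<Gamma>)" for B
  proof
    show "All B \<in> \<Gamma> \<Longrightarrow> \<forall>t. inst B t \<in> \<Gamma>" using ded[OF all_inst] by blast
    assume "\<forall>t. inst B t \<in> \<Gamma>"
    then have "Neg (All B) \<notin> \<Gamma>" using \<Gamma> neg unfolding henkin_def by blast
    then show "All B \<in> \<Gamma>" using neg by blast
  qed
  let ?l = "tsub (\<lambda>n. Var (Suc n))"
  have refl: "Eq t t \<in> \<Gamma>" for t by (intro prov eq_refl)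
  have subst: "inst B t \<in> \<Gamma>" if "Eq s t \<in> \<Gamma>" "inst B s \<in> \<Gamma>" for B s t
    using that prov[OF eq_subst] imp by blast
  have sym: "Eq t s \<in> \<Gamma>" if "Eq s t \<in> \<Gamma>" for s t
    using subst[of s t "Eq (Var 0) (?l s)"] that refl by (simp add: inst_def tsub_tsub tsub_Var)
  have trans: "Eq s u \<in> \<Gamma>" if "Eq s t \<in> \<Gamma>" "Eq t u \<in> \<Gamma>" for s t u
    using subst[of t u "Eq (?l s) (Var 0)"] that by (simp add: inst_def tsub_tsub tsub_Var)
  have cong_Succ: "Eq (Succ s) (Succ t) \<in> \<Gamma>" if "Eq s t \<in> \<Gamma>" for s t
    using subst[of s t "Eq (Succ (?l s)) (Succ (Var 0))"] that refl
    by (simp add: inst_def tsub_tsub tsub_Var)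
  have cong_Add: "Eq (Add s u) (Add t v) \<in> \<Gamma>" if "Eq s t \<in> \<Gamma>" "Eq u v \<in> \<Gamma>" for s t u v
    using subst[of s t "Eq (Add (?l s) (?l u)) (Add (Var 0) (?l u))"]
      subst[of u v "Eq (Add (?l s) (?l u)) (Add (?l t) (Var 0))"] that refl
    by (simp add: inst_def tsub_tsub tsub_Var)
  have cong_Mul: "Eq (Mul s u) (Mul t v) \<in> \<Gamma>" if "Eq s t \<in> \<Gamma>" "Eq u v \<in> \<Gamma>" for s t u v
    using subst[of s t "Eq (Mul (?l s) (?l u)) (Mul (Var 0) (?l u))"]
      subst[of u v "Eq (Mul (?l s) (?l u)) (Mul (?l t) (Var 0))"] that refl
    by (simp add: inst_def tsub_tsub tsub_Var)
  have var: "\<exists>y. Eq t (Var y) \<in> \<Gamma>" for t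
  proof -
    let ?B = "Neg (Eq (?l t) (Var 0))"
    have B: "inst ?B u = Neg (Eq t u)" for u by (simp add: inst_def tsub_tsub tsub_Var)
    have "Neg (All ?B) \<in> \<Gamma>" unfolding neg all B using refl by blast
    then obtain y where "Neg (inst ?B (Var y)) \<in> \<Gamma>" using \<Gamma> unfolding henkin_def by blast
    then show ?thesis unfolding B neg by blast
  qed

  define R where "R t = {u. Eq t u \<in> \<Gamma>}" for t
  have R: "R s = R t \<longleftrightarrow> Eq s t \<in> \<Gamma>" for s t
    unfolding R_def using refl sym trans by blast
  \<comment> \<open>Numerals lie in pairwise distinct classes by the successor axioms. So there are
    infinitely many classes, and numbering them exhausts \<open>nat\<close>.\<close>
  define numeral where "numeral n = (Succ ^^ n) Zero" for n
  have Z: "Eq (Succ t) Zero \<notin> \<Gamma>" for t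
  proof -
    have "PA \<turnstile> sub (\<lambda>_. t) (Neg (Eq (Succ (Var 0)) Zero))"
      by (intro proves_sub subst_closed_PA ax PA.intros)
    from prov[OF this] show ?thesis by (simp add: neg)
  qed
  have S: "Eq s t \<in> \<Gamma>" if "Eq (Succ s) (Succ t) \<in> \<Gamma>" for s t
  proof -
    have "PA \<turnstile> sub (case_nat s (\<lambda>_. t)) (Imp (Eq (Succ (Var 0)) (Succ (Var 1))) (Eq (Var 0) (Var 1)))"
      by (intro proves_sub subst_closed_PA ax PA.intros)
    from prov[OF this] that show ?thesis by (simp add: imp)
  qed
  have "m = n" if "Eq (numeral m) (numeral n) \<in> \<Gamma>" for m n
    using that
  proof (induction m arbitrary: n)
    case 0
    then show ?case using Z sym by (cases n) (auto simp: numeral_def)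
  next
    case (Suc m)
    then show ?case using Z S by (cases n) (auto simp: numeral_def)
  qed
  then have "inj (\<lambda>n. R (numeral n))" unfolding inj_def R by blast
  then have inf: "infinite (range R)"
    using finite_subset[of "range (\<lambda>n. R (numeral n))" "range R"] finite_imageD by blast
  define Q where "Q t = to_nat_on (range R) (R t)" for t
  have Q: "Q s = Q t \<longleftrightarrow> Eq s t \<in> \<Gamma>" for s t
    unfolding Q_def R[symmetric] by (rule to_nat_on_inj) (auto simp: countable_image[OF countableI_type])
  have surj: "surj Q"
    using bij_betw_imp_surj_on[OF to_nat_on_infinite[OF _ inf]]
    unfolding Q_def image_image[symmetric, of _ R] by simp
  define e where "e n = Q (Var n)" for n
  define rep where "rep = inv Q"
  have rep: "Q (rep x) = x" for x unfolding rep_def using surj by (rule surj_f_inv_f)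
  have rep': "Eq (rep (Q t)) t \<in> \<Gamma>" for t using rep Q by blast
  let ?tval = "tval (Q Zero) (\<lambda>x. Q (Succ (rep x))) (\<lambda>x y. Q (Add (rep x) (rep y)))
     (\<lambda>x y. Q (Mul (rep x) (rep y)))"
  let ?sat = "sat (Q Zero) (\<lambda>x. Q (Succ (rep x))) (\<lambda>x y. Q (Add (rep x) (rep y)))
     (\<lambda>x y. Q (Mul (rep x) (rep y)))"
  have tval: "?tval e t = Q t" for t
    by (induction t) (auto simp: Q e_def intro: cong_Succ cong_Add cong_Mul rep')
  have sat: "?sat e B \<longleftrightarrow> B \<in> \<Gamma>" for B
  proof (induction "fsize B" arbitrary: B rule: less_induct)
    case less
    show ?case
    proof (cases B)
      case (All C)
      \<comment> \<open>Every element is the class of a term, so quantifying over elements amounts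
        to quantifying over terms.\<close>
      have "(\<forall>x. ?sat (case_nat x e) C) \<longleftrightarrow> (\<forall>t. ?sat e (inst C t))"
        unfolding sat_inst tval by (metis rep)
      also have "\<dots> \<longleftrightarrow> (\<forall>t. inst C t \<in> \<Gamma>)"
        using less All by (simp add: inst_def fsize_sub)
      finally show ?thesis by (simp add: All all)
    qed (use less in \<open>auto simp: tval Q neg imp\<close>)
  qed
  \<comment> \<open>The truth lemma speaks about the assignment \<open>e\<close> only. Any other
    assignment is reached by substituting representatives for the variables, under which the axioms
    remain provable.\<close>
  have "?sat \<rho> B" if "B \<in> PA" for \<rho> B
  proof -
    have "PA \<turnstile> sub (\<lambda>n. rep (\<rho> n)) B" using subst_closed_PA that unfolding subst_closed_def by blast
    then have "?sat e (sub (\<lambda>n. rep (\<rho> n)) B)" unfolding sat by (rule prov)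
    then show ?thesis by (simp add: sat_sub tval rep)
  qed
  moreover have "\<not> ?sat e A" using A by (simp add: sat neg)
  ultimately show ?thesis by blast
qed


section \<open>Truth in a structure\<close>

text \<open>Successor is read as \<open>x + 1\<close>, so that a structure is given by the algebraic
  operations of a type alone.\<close>

abbreviation val :: "(nat \<Rightarrow> 'm::{zero,one,plus,times}) \<Rightarrow> tm \<Rightarrow> 'm" where
  "val \<equiv> tval 0 (\<lambda>x. x + 1) (+) (*)"

abbreviation holds :: "(nat \<Rightarrow> 'm::{zero,one,plus,times}) \<Rightarrow> fm \<Rightarrow> bool" where
  "holds \<equiv> sat 0 (\<lambda>x. x + 1) (+) (*)"

definition env :: "(nat \<Rightarrow> 'm) \<Rightarrow> 'm list \<Rightarrow> nat \<Rightarrow> 'm" where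
  "env b xs n = (if n < length xs then xs ! n else b (n - length xs))"

lemma env_Nil: "env b [] = b"
  by (rule ext) (simp add: env_def)

lemma env_Cons: "env b (x # xs) = case_nat x (env b xs)"
  by (rule ext) (simp add: env_def split: nat.split)

text \<open>
  The values of the bound variables form a stack \<open>xs\<close>, innermost first, on top of an
  environment \<open>b\<close>. Since a term of type \<^typ>\<open>dtm\<close> may be used under further quantifiers,
  its value has to be the same in all extensions of the stack.
\<close>

named_theorems denI

definition den :: "(nat \<Rightarrow> 'm::{zero,one,plus,times}) \<Rightarrow> 'm list \<Rightarrow> dtm \<Rightarrow> 'm \<Rightarrow> bool" where
  "den b xs s x \<longleftrightarrow> (\<forall>zs. val (env b (zs @ xs)) (s (length (zs @ xs))) = x)"

definition fden :: "(nat \<Rightarrow> 'm::{zero,one,plus,times}) \<Rightarrow> 'm list \<Rightarrow> dfm \<Rightarrow> bool \<Rightarrow> bool" where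
  "fden b xs P p \<longleftrightarrow> (\<forall>zs. holds (env b (zs @ xs)) (P (length (zs @ xs))) = p)"

text \<open>For predicates that are parameters of a formula, such as the premises \<open>X\<close>
  of a rule. They are applied under further quantifiers, hence the closure under extensions of the
  stack.\<close>

definition pden :: "(nat \<Rightarrow> 'm::{zero,one,plus,times}) \<Rightarrow> 'm list \<Rightarrow> (dtm \<Rightarrow> dfm) \<Rightarrow> ('m \<Rightarrow> bool) \<Rightarrow> bool" where
  "pden b xs P p \<longleftrightarrow> (\<forall>zs s x. den b (zs @ xs) s x \<longrightarrow> fden b (zs @ xs) (P s) (p x))"

lemma den_append: "den b xs s x \<Longrightarrow> den b (ys @ xs) s x"
  unfolding den_def by (metis append_assoc)

lemma den_Cons: "den b xs s x \<Longrightarrow> den b (y # xs) s x"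
  using den_append[of b xs s x "[y]"] by simp

lemma pden_append: "pden b xs s x \<Longrightarrow> pden b (ys @ xs) s x"
  unfolding pden_def by (metis append_assoc)

lemma pden_Cons: "pden b xs s x \<Longrightarrow> pden b (y # xs) s x"
  using pden_append[of b xs s x "[y]"] by simp

lemma pdenI:
  "(\<And>zs s x. den b (zs @ xs) s x \<Longrightarrow> fden b (zs @ xs) (P s) (p x)) \<Longrightarrow> pden b xs P p"
  by (simp add: pden_def)

lemma pdenD: "pden b xs P p \<Longrightarrow> den b xs s x \<Longrightarrow> fden b xs (P s) (p x)"
  unfolding pden_def by (metis append_Nil)

lemma den_bvar [denI]: "den b (x # xs) (bvar (length xs)) x"
  by (auto simp: den_def bvar_def env_def nth_append)

text \<open>The index \<open>d + n\<close> reaches past all \<open>d\<close> bound variables into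
  the base environment, so such a term denotes a parameter.\<close>

lemma den_const: "den b xs (\<lambda>d. Var (d + n)) (b n)"
  by (auto simp: den_def env_def)

lemma den_zero [denI]: "den b xs (num 0) 0"
  by (simp add: den_def)

lemma den_succ [denI]: "den b xs s x \<Longrightarrow> den b xs (\<^bold>S s) (x + 1)"
  by (simp add: den_def dsucc_def)

lemma den_add [denI]: "den b xs s x \<Longrightarrow> den b xs t y \<Longrightarrow> den b xs (s \<^bold>+ t) (x + y)"
  by (simp add: den_def dadd_def)

lemma den_mult [denI]: "den b xs s x \<Longrightarrow> den b xs t y \<Longrightarrow> den b xs (s \<^bold>* t) (x * y)"
  by (simp add: den_def dmul_def)

lemma fden_eq [denI]: "den b xs s x \<Longrightarrow> den b xs t y \<Longrightarrow> fden b xs (s \<^bold>= t) (x = y)"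
  by (simp add: fden_def den_def deq_def)

lemma fden_not [denI]: "fden b xs P p \<Longrightarrow> fden b xs (\<^bold>\<not> P) (\<not> p)"
  by (simp add: fden_def dneg_def)

lemma fden_imp [denI]: "fden b xs P p \<Longrightarrow> fden b xs Q q \<Longrightarrow> fden b xs (P \<^bold>\<longrightarrow> Q) (p \<longrightarrow> q)"
  by (simp add: fden_def dimp_def)

lemma fden_conj [denI]: "fden b xs P p \<Longrightarrow> fden b xs Q q \<Longrightarrow> fden b xs (P \<^bold>\<and> Q) (p \<and> q)"
  by (simp add: fden_def dimp_def dneg_def dconj_def)

lemma fden_disj [denI]: "fden b xs P p \<Longrightarrow> fden b xs Q q \<Longrightarrow> fden b xs (P \<^bold>\<or> Q) (p \<or> q)"
  by (auto simp: fden_def dimp_def dneg_def ddisj_def)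

lemma fden_all [denI]:
  assumes "\<And>zs x. fden b (x # zs @ xs) (P (bvar (length (zs @ xs)))) (p x)"
  shows "fden b xs (dall P) (\<forall>x. p x)"
  unfolding fden_def
proof
  fix zs
  have "holds (env b (x # zs @ xs)) (P (bvar (length (zs @ xs))) (length (x # zs @ xs))) = p x" for x
    using assms[of x zs] unfolding fden_def by (metis append_Nil)
  then show "holds (env b (zs @ xs)) (dall P (length (zs @ xs))) = (\<forall>x. p x)"
    by (simp add: dall_def env_Cons)
qed

lemma fden_ex [denI]:
  assumes "\<And>zs x. fden b (x # zs @ xs) (P (bvar (length (zs @ xs)))) (p x)"
  shows "fden b xs (dex P) (\<exists>x. p x)"
proof -
  have "fden b xs (dex P) (\<not> (\<forall>x. \<not> p x))"
    unfolding dex_def by (intro fden_not fden_all assms)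
  then show ?thesis by simp
qed

lemmas mono_rules = den_Cons den_append pden_Cons pden_append

text \<open>Definability with parameters: the base environment \<open>from_nat\<close> takes every
  element of the model as a value, so that each element is named by a free variable.\<close>

definition definable :: "('m::{zero,one,plus,times,countable} \<Rightarrow> bool) \<Rightarrow> bool" where
  "definable p \<longleftrightarrow> (\<exists>P. \<forall>xs. pden from_nat xs P p)"

lemma den_element: "den from_nat xs (\<lambda>d. Var (d + to_nat x)) x"
  using den_const[of from_nat xs "to_nat x"] by simp

text \<open>When the rule is applied, \<open>P\<close> may remain schematic: resolving with
  \<open>denI\<close> along the structure of \<open>p\<close> builds the formula.\<close>

lemma definableI:
  "(\<And>xs s x. den from_nat xs s x \<Longrightarrow> fden from_nat xs (P s) (p x)) \<Longrightarrow> definable p"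
  unfolding definable_def pden_def by blast

lemma definableD:
  "definable p \<Longrightarrow> \<exists>P. \<forall>xs s x. den from_nat xs s x \<longrightarrow> fden from_nat xs (P s) (p x)"
  unfolding definable_def by (meson pdenD)


section \<open>Arithmetic in models of PA\<close>

class pa_model = zero + one + plus + minus + times + ord + countable +
  assumes PA_holds: "A \<in> PA \<Longrightarrow> sat 0 (\<lambda>x. x + 1) (+) (*) \<rho> A"
    and le_iff_ex: "x \<le> y \<longleftrightarrow> (\<exists>z. x + z = y)"
    and less_iff_ex: "x < y \<longleftrightarrow> (\<exists>z. x + 1 + z = y)"
    and minus_eq: "x - y = (if y \<le> x then THE z. y + z = x else 0)"

lemma pa_induct:
  fixes p :: "'m::pa_model \<Rightarrow> bool"
  assumes "definable p" "p 0" "\<And>x. p x \<Longrightarrow> p (x + 1)"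
  shows "p x"
proof -
  obtain P where P: "\<And>xs s x. den from_nat xs s x \<Longrightarrow> fden from_nat xs (P s) (p x)"
    using definableD[OF assms(1)] by blast
  \<comment> \<open>Under one quantifier \<open>bvar 0\<close> is variable 0, the induction
    variable. All other free variables of \<open>A\<close> are read by \<open>from_nat\<close> and
    are the parameters.\<close>
  define A where "A = P (bvar 0) (Suc 0)"
  have A: "holds (case_nat x from_nat) A \<longleftrightarrow> p x" for x :: 'm
    using P[of "[x]" "bvar 0" x] den_bvar[of from_nat x "[]"]
    unfolding A_def fden_def by (auto simp: env_Cons env_Nil dest: spec[of _ "[]"])
  have "(\<lambda>n. val (case_nat x from_nat) (case_nat (Succ (Var 0)) (\<lambda>n. Var (Suc n)) n)) =
      case_nat (x + 1) from_nat" for x :: 'm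
    by (rule ext) (auto split: nat.split)
  then show ?thesis
    using PA_holds[OF PA.induction[of A], of "from_nat :: nat \<Rightarrow> 'm"] assms(2,3)
    by (auto simp: sat_inst sat_sub A)
qed

lemma pa_succ_neq_0: "x + 1 \<noteq> (0::'m::pa_model)"
  using PA_holds[OF PA.Succ_neq_Zero, of "\<lambda>_. x"] by simp

lemma pa_succ_inject: "x + 1 = y + 1 \<Longrightarrow> x = (y::'m::pa_model)"
  using PA_holds[OF PA.Succ_inject, of "case_nat x (\<lambda>_. y)"] by simp

lemma pa_add_0: "x + 0 = (x::'m::pa_model)"
  using PA_holds[OF PA.Add_Zero, of "\<lambda>_. x"] by simp

lemma pa_add_succ: "x + (y + 1) = x + y + (1::'m::pa_model)"
  using PA_holds[OF PA.Add_Succ, of "case_nat x (\<lambda>_. y)"] by simp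

lemma pa_mult_0: "x * 0 = (0::'m::pa_model)"
  using PA_holds[OF PA.Mul_Zero, of "\<lambda>_. x"] by simp

lemma pa_mult_succ: "x * (y + 1) = x * y + (x::'m::pa_model)"
  using PA_holds[OF PA.Mul_Succ, of "case_nat x (\<lambda>_. y)"] by simp

lemma pa_zero_add: "0 + x = (x::'m::pa_model)"
proof (rule pa_induct[of "\<lambda>x. 0 + x = x"])
  show "definable (\<lambda>x. 0 + x = (x::'m))"
    by (rule definableI) (assumption | rule denI | rule mono_rules | rule den_element)+
qed (simp_all add: pa_add_0 pa_add_succ)

lemma pa_add_assoc: "x + y + z = x + (y + (z::'m::pa_model))"
proof (rule pa_induct[of "\<lambda>z. x + y + z = x + (y + z)"])
  show "definable (\<lambda>z. x + y + z = x + (y + z))"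
    by (rule definableI) (assumption | rule denI | rule mono_rules | rule den_element)+
qed (simp_all add: pa_add_0 pa_add_succ)

lemma pa_succ_add: "(x + 1) + y = x + y + (1::'m::pa_model)"
proof (rule pa_induct[of "\<lambda>y. (x + 1) + y = x + y + 1"])
  show "definable (\<lambda>y. (x + 1) + y = x + y + 1)"
    by (rule definableI) (assumption | rule denI | rule mono_rules | rule den_element)+
qed (simp_all add: pa_add_0 pa_add_succ)

lemma pa_add_commute: "x + y = y + (x::'m::pa_model)"
proof (rule pa_induct[of "\<lambda>y. x + y = y + x"])
  show "definable (\<lambda>y. x + y = y + x)"
    by (rule definableI) (assumption | rule denI | rule mono_rules | rule den_element)+
qed (simp_all add: pa_add_0 pa_add_succ pa_zero_add pa_succ_add)

lemma pa_zero_mult: "0 * x = (0::'m::pa_model)"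
proof (rule pa_induct[of "\<lambda>x. 0 * x = 0"])
  show "definable (\<lambda>x. 0 * x = (0::'m))"
    by (rule definableI) (assumption | rule denI | rule mono_rules | rule den_element)+
qed (simp_all add: pa_mult_0 pa_add_0 pa_mult_succ)

lemma pa_add_left_commute: "y + (x + z) = x + (y + (z::'m::pa_model))"
  by (metis pa_add_assoc pa_add_commute)

lemma pa_succ_mult: "(x + 1) * y = x * y + (y::'m::pa_model)"
proof (rule pa_induct[of "\<lambda>y. (x + 1) * y = x * y + y"])
  show "definable (\<lambda>y. (x + 1) * y = x * y + y)"
    by (rule definableI) (assumption | rule denI | rule mono_rules | rule den_element)+
qed (simp_all add: pa_mult_0 pa_mult_succ pa_add_0, simp add: pa_add_assoc pa_add_left_commute)

lemma pa_mult_commute: "x * y = y * (x::'m::pa_model)"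
proof (rule pa_induct[of "\<lambda>y. x * y = y * x"])
  show "definable (\<lambda>y. x * y = y * x)"
    by (rule definableI) (assumption | rule denI | rule mono_rules | rule den_element)+
qed (simp_all add: pa_mult_0 pa_zero_mult pa_mult_succ pa_succ_mult)

lemma pa_distrib: "(x + y) * z = x * z + y * (z::'m::pa_model)"
proof (rule pa_induct[of "\<lambda>z. (x + y) * z = x * z + y * z"])
  show "definable (\<lambda>z. (x + y) * z = x * z + y * z)"
    by (rule definableI) (assumption | rule denI | rule mono_rules | rule den_element)+
qed (simp_all add: pa_mult_0 pa_mult_succ pa_add_0, simp add: pa_add_assoc pa_add_left_commute)

lemma pa_mult_assoc: "x * y * z = x * (y * (z::'m::pa_model))"
proof (rule pa_induct[of "\<lambda>z. x * y * z = x * (y * z)"])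
  show "definable (\<lambda>z. x * y * z = x * (y * z))"
    by (rule definableI) (assumption | rule denI | rule mono_rules | rule den_element)+
  show "x * y * (z + 1) = x * (y * (z + 1))" if "x * y * z = x * (y * z)" for z
    using that by (simp add: pa_mult_succ) (metis pa_distrib pa_mult_commute)
qed (simp_all add: pa_mult_0)

lemma pa_add_right_imp_eq: "x + z = y + z \<Longrightarrow> x = (y::'m::pa_model)"
proof -
  have "x + z = y + z \<longrightarrow> x = y"
  proof (rule pa_induct[of "\<lambda>z. x + z = y + z \<longrightarrow> x = y"])
    show "definable (\<lambda>z. x + z = y + z \<longrightarrow> x = y)"
      by (rule definableI) (assumption | rule denI | rule mono_rules | rule den_element)+
  qed (auto simp: pa_add_0 pa_add_assoc[symmetric] dest: pa_succ_inject)
  then show "x + z = y + z \<Longrightarrow> x = y" by blast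
qed

lemma pa_zero_or_succ: "x = 0 \<or> (\<exists>y. x = y + (1::'m::pa_model))"
proof (rule pa_induct[of "\<lambda>x. x = 0 \<or> (\<exists>y. x = y + 1)"])
  show "definable (\<lambda>x::'m. x = 0 \<or> (\<exists>y. x = y + 1))"
    by (rule definableI) (assumption | rule denI | rule mono_rules | rule den_element)+
qed auto

lemma pa_add_eq_0: "x + y = 0 \<Longrightarrow> y = (0::'m::pa_model)"
  using pa_zero_or_succ[of y] by (metis pa_add_assoc pa_succ_neq_0)

lemma pa_linear: "x \<le> y \<or> y \<le> (x::'m::pa_model)"
  unfolding le_iff_ex
proof (rule pa_induct[of "\<lambda>y. (\<exists>z. x + z = y) \<or> (\<exists>z. y + z = x)"])
  show "definable (\<lambda>y::'m. (\<exists>z. x + z = y) \<or> (\<exists>z. y + z = x))"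
    by (rule definableI) (assumption | rule denI | rule mono_rules | rule den_element)+
  show "(\<exists>z. x + z = 0) \<or> (\<exists>z. 0 + z = x)" by (simp add: pa_zero_add)
  fix y
  assume "(\<exists>z. x + z = y) \<or> (\<exists>z. y + z = x)"
  then show "(\<exists>z. x + z = y + 1) \<or> (\<exists>z. y + 1 + z = x)"
  proof
    assume "\<exists>z. x + z = y"
    then show ?thesis by (metis pa_add_assoc)
  next
    assume "\<exists>z. y + z = x"
    then obtain z where z: "y + z = x" by blast
    show ?thesis using pa_zero_or_succ[of z] z by (metis pa_add_0 pa_add_assoc pa_add_commute)
  qed
qed

lemma pa_antisym: "x \<le> y \<Longrightarrow> y \<le> x \<Longrightarrow> x = (y::'m::pa_model)"
  unfolding le_iff_ex by (metis pa_add_0 pa_add_assoc pa_add_commute pa_add_eq_0 pa_add_right_imp_eq)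

lemma pa_diff_eq: "y + z = x \<Longrightarrow> x - y = (z::'m::pa_model)"
  unfolding minus_eq le_iff_ex
  by (auto intro!: the_equality) (metis pa_add_commute pa_add_right_imp_eq)

lemma pa_diff_eq_0: "\<not> y \<le> x \<Longrightarrow> x - y = (0::'m::pa_model)"
  by (simp add: minus_eq)

lemma pa_less_iff: "x < y \<longleftrightarrow> x \<le> y \<and> x \<noteq> (y::'m::pa_model)"
proof -
  have "x \<noteq> x + 1 + z" for z
    by (metis pa_add_0 pa_add_assoc pa_add_commute pa_add_eq_0 pa_add_right_imp_eq pa_succ_neq_0)
  then show ?thesis
    unfolding less_iff_ex le_iff_ex by (metis pa_add_0 pa_add_assoc pa_add_commute pa_zero_or_succ)
qed

lemma pa_mult_eq_0: "x * y = 0 \<Longrightarrow> x = 0 \<or> y = (0::'m::pa_model)"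
  using pa_zero_or_succ[of y] by (auto simp: pa_mult_succ dest: pa_add_eq_0)

lemma pa_add_left_mono: "y \<le> z \<Longrightarrow> x + y \<le> x + (z::'m::pa_model)"
  unfolding le_iff_ex by (metis pa_add_assoc)

section \<open>Models of PA as ordered semirings\<close>

instance pa_model \<subseteq> linordered_semidom
proof
  fix a b c :: 'a
  show "a + b + c = a + (b + c)" by (rule pa_add_assoc)
  show "a + b = b + a" by (rule pa_add_commute)
  show "0 + a = a" by (rule pa_zero_add)
  show "a * b * c = a * (b * c)" by (rule pa_mult_assoc)
  show "a * b = b * a" by (rule pa_mult_commute)
  show "1 * a = a" by (metis pa_zero_add pa_zero_mult pa_succ_mult)
  show "(a + b) * c = a * c + b * c" by (rule pa_distrib)
  show "a * (b + c) = a * b + a * c" by (metis pa_distrib pa_mult_commute)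
  show "0 * a = 0" by (rule pa_zero_mult)
  show "a * 0 = 0" by (rule pa_mult_0)
  show "(0::'a) \<noteq> 1" by (metis pa_succ_neq_0 pa_zero_add)
  show "a + b - a = b" by (rule pa_diff_eq) simp
  show "a - b - c = a - (b + c)"
  proof (cases "b + c \<le> a")
    case True
    then obtain d where "b + c + d = a" unfolding le_iff_ex by blast
    then show ?thesis by (metis pa_add_assoc pa_diff_eq)
  next
    case False
    show ?thesis
    proof (cases "b \<le> a")
      case True
      then obtain d where d: "b + d = a" unfolding le_iff_ex by blast
      with False have "\<not> c \<le> d" using pa_add_left_mono by blast
      with d False show ?thesis by (simp add: pa_diff_eq pa_diff_eq_0)
    next
      case b: False
      have "0 - c = 0"
      proof (cases "c \<le> 0")
        case True
        then obtain d where "c + d = 0" unfolding le_iff_ex by blast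
        then show ?thesis by (metis pa_add_eq_0 pa_diff_eq)
      qed (rule pa_diff_eq_0)
      with b False show ?thesis by (simp add: pa_diff_eq_0)
    qed
  qed
  show "a * (b - c) = a * b - a * c"
  proof (cases "c \<le> b")
    case True
    then obtain d where d: "c + d = b" unfolding le_iff_ex by blast
    then have "a * c + a * d = a * b" by (metis pa_distrib pa_mult_commute)
    with d show ?thesis by (simp add: pa_diff_eq)
  next
    case False
    then obtain d where "b + d = c" "d \<noteq> 0" using pa_linear unfolding le_iff_ex by (metis pa_add_0)
    then have ac: "a * c = a * b + a * d" by (metis pa_distrib pa_mult_commute)
    have "a * b - a * c = 0"
    proof (cases "a * c \<le> a * b")
      case True
      then have "a * b = a * c" using ac pa_antisym le_iff_ex by metis
      then show ?thesis by (metis pa_add_0 pa_diff_eq)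
    qed (rule pa_diff_eq_0)
    with False show ?thesis by (simp add: pa_diff_eq_0 pa_mult_0)
  qed
  show le: "a \<le> a" unfolding le_iff_ex by (metis pa_add_0)
  show "a \<le> b \<Longrightarrow> b \<le> c \<Longrightarrow> a \<le> c" unfolding le_iff_ex by (metis pa_add_assoc)
  show "a \<le> b \<Longrightarrow> b \<le> a \<Longrightarrow> a = b" by (rule pa_antisym)
  show "a \<le> b \<or> b \<le> a" by (rule pa_linear)
  show "(a < b) = (a \<le> b \<and> \<not> b \<le> a)" using pa_antisym le pa_less_iff by metis
  show "a \<le> b \<Longrightarrow> c + a \<le> c + b" by (rule pa_add_left_mono)
  show "(0::'a) < 1" unfolding less_iff_ex by (metis pa_zero_add pa_add_0)
  show "a < b \<Longrightarrow> 0 < c \<Longrightarrow> c * a < c * b"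
  proof -
    assume "a < b" "0 < c"
    then obtain d e where d: "a + 1 + d = b" and e: "0 + 1 + e = c" unfolding less_iff_ex by blast
    have "c * b = c * a + c * (1 + d)" using d by (metis pa_add_assoc pa_distrib pa_mult_commute)
    moreover have "c * (1 + d) = c * d + c" by (metis pa_mult_succ pa_add_commute)
    ultimately show "c * a < c * b" using e unfolding less_iff_ex
      by (metis pa_zero_add pa_add_assoc pa_add_commute)
  qed
  show "b \<le> a \<Longrightarrow> a - b + b = a"
    unfolding le_iff_ex using pa_diff_eq pa_add_commute by metis
  show "a * b \<noteq> 0" if "a \<noteq> 0" "b \<noteq> 0" using that pa_mult_eq_0 by blast
qed

lemma den_one [denI]: "den b xs (num 1) (1::'m::pa_model)"
  using den_succ[OF den_zero, of b xs] by simp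

lemma den_numeral [denI]: "den b xs (num (numeral k)) (numeral k :: 'm::pa_model)"
proof -
  have "den b xs (num n) (of_nat n :: 'm)" for n
  proof (induction n)
    case (Suc n)
    then show ?case using den_succ[OF Suc] by (simp add: add.commute)
  qed (use den_zero in simp)
  from this[of "numeral k"] show ?thesis by simp
qed

lemma fden_le [denI]:
  "den b xs s (x::'m::pa_model) \<Longrightarrow> den b xs t y \<Longrightarrow> fden b xs (s \<^bold>\<le> t) (x \<le> y)"
  unfolding dle_def le_iff_ex by (assumption | rule denI | rule mono_rules)+

lemma fden_less [denI]:
  "den b xs s (x::'m::pa_model) \<Longrightarrow> den b xs t y \<Longrightarrow> fden b xs (s \<^bold>< t) (x < y)"
  unfolding dless_def dle_def less_iff_ex by (assumption | rule denI | rule mono_rules)+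

lemma less_succ_iff: "x < y + 1 \<longleftrightarrow> x \<le> (y::'m::pa_model)"
proof -
  have "x + 1 + z = y + 1 \<longleftrightarrow> x + z = y" for z
    by (metis add.assoc add.commute add_right_cancel)
  then show ?thesis by (simp add: less_iff_ex le_iff_ex)
qed

lemma succ_le_iff: "x + 1 \<le> y \<longleftrightarrow> x < (y::'m::pa_model)"
  by (metis add.assoc add.commute le_iff_ex less_iff_ex)

lemma pa_nonneg [simp]: "0 \<le> (x::'m::pa_model)"
  by (auto simp: le_iff_ex)

lemma pa_le_0_iff [simp]: "x \<le> 0 \<longleftrightarrow> x = (0::'m::pa_model)"
  by (metis antisym pa_nonneg)

lemma pos_iff: "0 < x \<longleftrightarrow> x \<noteq> (0::'m::pa_model)"
  by (metis pa_nonneg less_le)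

lemma pa_less_induct:
  fixes p :: "'m::pa_model \<Rightarrow> bool"
  assumes p: "definable p" and step: "\<And>x. (\<And>y. y < x \<Longrightarrow> p y) \<Longrightarrow> p x"
  shows "p x"
proof -
  obtain P where P [denI]: "\<And>xs s x. den from_nat xs s x \<Longrightarrow> fden from_nat xs (P s) (p x)"
    using definableD[OF p] by blast
  have "\<forall>y. y \<le> x \<longrightarrow> p y"
  proof (rule pa_induct[of "\<lambda>x. \<forall>y. y \<le> x \<longrightarrow> p y"])
    show "definable (\<lambda>x. \<forall>y. y \<le> x \<longrightarrow> p y)"
      by (rule definableI) (assumption | rule denI | rule mono_rules | rule den_element)+
    show "\<forall>y. y \<le> 0 \<longrightarrow> p y" using step by (metis antisym_conv less_le_trans not_less pa_nonneg)
    show "\<forall>y. y \<le> x + 1 \<longrightarrow> p y" if "\<forall>y. y \<le> x \<longrightarrow> p y" for x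
      using that step by (metis less_succ_iff order.order_iff_strict order.strict_trans1)
  qed
  then show ?thesis by blast
qed


section \<open>Sequences and derivations in models of PA\<close>

text \<open>The prefix \<open>n\<close> marks the counterpart in a model of a notion of arithmetic.\<close>

definition npair :: "'m::pa_model \<Rightarrow> 'm \<Rightarrow> 'm" where
  "npair x y = (x + y) * (x + y) + x"

definition ncons :: "'m::pa_model \<Rightarrow> 'm \<Rightarrow> 'm" where
  "ncons x y = npair x y + 1"

lemma den_pair [denI]: "den b xs s x \<Longrightarrow> den b xs t y \<Longrightarrow> den b xs (pair s t) (npair x y)"
  unfolding pair_def npair_def by (assumption | rule denI)+

lemma den_cons [denI]: "den b xs s x \<Longrightarrow> den b xs t y \<Longrightarrow> den b xs (cons s t) (ncons x y)"
  unfolding cons_def ncons_def by (assumption | rule denI)+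

text \<open>With n = x + y the code lies between n * n and n * n + n, hence below (n + 1) * (n + 1).
  So the code determines the sum, and then both summands.\<close>

lemma npair_less:
  assumes "x + y < x' + y'"
  shows "npair x y < npair x' (y'::'m::pa_model)"
proof -
  let ?n = "x + y"
  have "npair x y \<le> ?n * ?n + ?n" unfolding npair_def by simp
  also have "?n * ?n + ?n \<le> ?n * ?n + ?n + ?n" by simp
  also have "?n * ?n + ?n + ?n < ?n * ?n + ?n + ?n + 1" by (simp add: less_succ_iff)
  also have "\<dots> = (?n + 1) * (?n + 1)" by (simp add: algebra_simps)
  also have "\<dots> \<le> (x' + y') * (x' + y')"
    using assms by (intro mult_mono) (auto simp: succ_le_iff)
  also have "\<dots> \<le> npair x' y'" unfolding npair_def by simp
  finally show ?thesis .
qed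

lemma npair_eq_iff [simp]: "npair x y = npair x' y' \<longleftrightarrow> x = x' \<and> y = (y'::'m::pa_model)"
proof
  assume eq: "npair x y = npair x' y'"
  then have "x + y = x' + y'" by (metis less_irrefl linorder_neqE npair_less)
  with eq show "x = x' \<and> y = y'" by (simp add: npair_def)
qed simp

lemma ncons_eq_iff [simp]: "ncons x y = ncons x' y' \<longleftrightarrow> x = x' \<and> y = (y'::'m::pa_model)"
  by (simp add: ncons_def)

lemma ncons_neq_0 [simp]: "ncons x y \<noteq> (0::'m::pa_model)" "0 \<noteq> ncons x y"
  unfolding ncons_def using pa_succ_neq_0 by metis+

text \<open>Congruence modulo \<open>m\<close>. Multiples are added on both sides because negative
  elements do not exist in a model.\<close>

definition cg :: "'m::pa_model \<Rightarrow> 'm \<Rightarrow> 'm \<Rightarrow> bool" where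
  "cg m a b \<longleftrightarrow> (\<exists>p q. a + p * m = b + q * m)"

lemma cg_refl: "cg m a a"
  unfolding cg_def by blast

lemma cg_trans: "cg m a b \<Longrightarrow> cg m b c \<Longrightarrow> cg m a c"
  unfolding cg_def
proof clarify
  fix p q r s assume "a + p * m = b + q * m" "b + r * m = c + s * m"
  then have "a + (p + r) * m = c + (q + s) * m"
    by (simp add: distrib_right) (metis add.assoc add.commute)
  then show "\<exists>p q. a + p * m = c + q * m" by blast
qed

lemma cg_add: "cg m a b \<Longrightarrow> cg m c d \<Longrightarrow> cg m (a + c) (b + d)"
  unfolding cg_def
proof clarify
  fix p q r s assume *: "a + p * m = b + q * m" "c + r * m = d + s * m"
  have "a + c + (p + r) * m = (a + p * m) + (c + r * m)" by (simp add: algebra_simps)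
  also have "\<dots> = b + d + (q + s) * m" unfolding * by (simp add: algebra_simps)
  finally show "\<exists>p q. a + c + p * m = b + d + q * m" by blast
qed

lemma cg_mult: "cg m a b \<Longrightarrow> cg m c d \<Longrightarrow> cg m (a * c) (b * d)"
  unfolding cg_def
proof clarify
  fix p q r s assume *: "a + p * m = b + q * m" "c + r * m = d + s * m"
  have "a * c + (a * r + p * c + p * r * m) * m = (a + p * m) * (c + r * m)" by (simp add: algebra_simps)
  also have "\<dots> = b * d + (b * s + q * d + q * s * m) * m" unfolding * by (simp add: algebra_simps)
  finally show "\<exists>p q. a * c + p * m = b * d + q * m" by blast
qed

lemma cg_add_multiple: "cg m (a + m * b) a"
  unfolding cg_def by (metis add.right_neutral mult.commute mult_zero_left)

section \<open>Remainders and Goedel's beta function\<close>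

definition nbeta :: "'m::pa_model \<Rightarrow> 'm \<Rightarrow> 'm \<Rightarrow> 'm \<Rightarrow> bool" where
  "nbeta c d i x \<longleftrightarrow> (\<exists>q. c = q * ((i + 1) * d + 1) + x) \<and> x < (i + 1) * d + 1"

lemma fden_beta [denI]:
  assumes "den b xs c c'" "den b xs d d'" "den b xs i i'" "den b xs x x'"
  shows "fden b xs (beta c d i x) (nbeta c' d' i' x')"
  unfolding beta_def nbeta_def using assms by - (assumption | rule denI | rule mono_rules)+

text \<open>Cancelling the smaller multiple turns the congruence into a division with remainder. The
  smaller one is that next to \<open>c\<close>, since otherwise \<open>x\<close> would reach the
  modulus.\<close>

lemma nbeta_cg:
  assumes "cg ((i + 1) * d + 1) c x" "x < (i + 1) * d + 1"
  shows "nbeta c d i (x::'m::pa_model)"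
proof -
  let ?m = "(i + 1) * d + 1"
  obtain p q where pq: "c + p * ?m = x + q * ?m" using assms(1) unfolding cg_def by blast
  have "p \<le> q"
  proof (rule ccontr)
    assume "\<not> p \<le> q"
    then obtain r where r: "p = q + 1 + r" by (metis less_iff_ex not_le)
    have "x + q * ?m = c + r * ?m + ?m + q * ?m" unfolding pq[symmetric] r by (simp add: algebra_simps)
    then have "x + q * ?m = (c + r * ?m + ?m) + q * ?m" by simp
    then have "x = c + r * ?m + ?m" by (rule add_right_imp_eq)
    then have "?m \<le> x" by (simp only: add_increasing pa_nonneg order_refl)
    with assms(2) show False by simp
  qed
  then obtain r where r: "q = p + r" by (metis le_iff_ex)
  have "c + p * ?m = (r * ?m + x) + p * ?m" using pq unfolding r by (simp only: distrib_right ac_simps)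
  then have "c = r * ?m + x" by (rule add_right_imp_eq)
  with assms(2) show ?thesis unfolding nbeta_def by blast
qed

lemma cg_less_eq:
  assumes "cg m x y" "x < m" "y < m"
  shows "x = (y::'m::pa_model)"
proof -
  have *: "x = y" if "x + p * m = y + q * m" "x < m" "p \<le> q" for x y p q :: 'm
  proof -
    obtain r where r: "q = p + r" using \<open>p \<le> q\<close> by (metis le_iff_ex)
    have "x + p * m = (y + r * m) + p * m" using that(1) unfolding r by (simp add: algebra_simps)
    then have x: "x = y + r * m" by (rule add_right_imp_eq)
    have "r = 0"
    proof (rule ccontr)
      assume "r \<noteq> 0"
      then have "1 * m \<le> r * m" by (intro mult_right_mono) (metis pos_iff succ_le_iff add_0, simp)
      then have "m \<le> x" unfolding x by (simp add: add_increasing)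
      with \<open>x < m\<close> show False by simp
    qed
    with x show ?thesis by simp
  qed
  obtain p q where pq: "x + p * m = y + q * m" using assms(1) unfolding cg_def by blast
  show ?thesis
  proof (cases "p \<le> q")
    case True
    from *[OF pq assms(2) True] show ?thesis .
  next
    case False
    then show ?thesis using *[OF pq[symmetric] assms(3)] by simp
  qed
qed

lemma nbeta_unique: "nbeta c d i x \<Longrightarrow> nbeta c d i y \<Longrightarrow> x = (y::'m::pa_model)"
proof -
  assume "nbeta c d i x" "nbeta c d i y"
  then obtain p q where "p * ((i + 1) * d + 1) + x = q * ((i + 1) * d + 1) + y"
    and less: "x < (i + 1) * d + 1" "y < (i + 1) * d + 1"
    unfolding nbeta_def by metis
  then have "cg ((i + 1) * d + 1) x y" unfolding cg_def by (metis add.commute)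
  then show ?thesis using less by (rule cg_less_eq)
qed

text \<open>Division with remainder by induction on \<open>c\<close>: the remainder grows by 1 or
  wraps around to 0.\<close>

lemma nbeta_ex: "\<exists>x. nbeta c d i (x::'m::pa_model)"
proof (rule pa_induct[of "\<lambda>c. \<exists>x. nbeta c d i x"])
  show "definable (\<lambda>c. \<exists>x. nbeta c d i x)"
    unfolding nbeta_def
    by (rule definableI) (assumption | rule denI | rule mono_rules | rule den_element)+
  have "nbeta 0 d i 0"
    unfolding nbeta_def by (metis add_0 less_succ_iff mult_zero_left pa_nonneg)
  then show "\<exists>x. nbeta 0 d i x" by blast
next
  fix c
  assume "\<exists>x. nbeta c d i x"
  then obtain q x where c: "c = q * ((i + 1) * d + 1) + x" and x: "x < (i + 1) * d + 1"
    unfolding nbeta_def by blast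
  show "\<exists>x. nbeta (c + 1) d i x"
  proof (cases "x = (i + 1) * d")
    case True
    have "nbeta (c + 1) d i 0"
      unfolding nbeta_def
    proof
      show "\<exists>q. c + 1 = q * ((i + 1) * d + 1) + 0"
        by (rule exI[of _ "q + 1"]) (simp add: c True algebra_simps)
    qed (metis less_succ_iff pa_nonneg)
    then show ?thesis by blast
  next
    case False
    have "nbeta (c + 1) d i (x + 1)"
      unfolding nbeta_def using c x False
      by (auto simp: add.assoc less_succ_iff succ_le_iff)
    then show ?thesis by blast
  qed
qed

text \<open>The common multiple takes the place of a factorial in Goedel's choice of moduli. The
  lower bound \<open>B\<close> will make the moduli exceed all entries of the sequence.\<close>

lemma common_multiple:
  "\<exists>d. B \<le> d \<and> (\<forall>x. 0 < x \<and> x \<le> n \<longrightarrow> (\<exists>e. d = x * (e::'m::pa_model)))"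
proof (rule pa_induct[of "\<lambda>n. \<exists>d. B \<le> d \<and> (\<forall>x. 0 < x \<and> x \<le> n \<longrightarrow> (\<exists>e. d = x * e))"])
  show "definable (\<lambda>n. \<exists>d. B \<le> d \<and> (\<forall>x. 0 < x \<and> x \<le> n \<longrightarrow> (\<exists>e. d = x * e)))"
    by (rule definableI) (assumption | rule denI | rule mono_rules | rule den_element)+
  show "\<exists>d. B \<le> d \<and> (\<forall>x. 0 < x \<and> x \<le> 0 \<longrightarrow> (\<exists>e. d = x * e))"
    by (rule exI[of _ B]) auto
  fix n
  assume "\<exists>d. B \<le> d \<and> (\<forall>x. 0 < x \<and> x \<le> n \<longrightarrow> (\<exists>e. d = x * e))"
  then obtain d where d: "B \<le> d" "\<And>x. 0 < x \<Longrightarrow> x \<le> n \<Longrightarrow> \<exists>e. d = x * e" by blast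
  show "\<exists>d. B \<le> d \<and> (\<forall>x. 0 < x \<and> x \<le> n + 1 \<longrightarrow> (\<exists>e. d = x * e))"
  proof (rule exI[of _ "d * (n + 1)"], intro conjI allI impI)
    show "B \<le> d * (n + 1)" using d(1) by (simp add: distrib_left add_increasing)
    fix x assume x: "0 < x \<and> x \<le> n + 1"
    show "\<exists>e. d * (n + 1) = x * e"
    proof (cases "x = n + 1")
      case True
      then show ?thesis by (metis mult.commute)
    next
      case False
      with x have "x \<le> n" by (metis less_succ_iff order.not_eq_order_implies_strict)
      then show ?thesis using d(2) x by (metis mult.assoc)
    qed
  qed
qed

text \<open>Coprimality appears as an inverse modulo the larger modulus. This is the form in which
  the Chinese remainder construction uses it, as congruences are solved in increasing order of the
  moduli.\<close>

lemma beta_moduli_coprime: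
  assumes "i < j" "j \<le> n" "\<forall>x. 0 < x \<and> x \<le> n \<longrightarrow> (\<exists>e. d = x * e)"
  shows "\<exists>u. cg ((j + 1) * d + 1) (((i + 1) * d + 1) * u) (1::'m::pa_model)"
proof -
  obtain x where x: "j = i + 1 + x" using assms(1) by (metis less_iff_ex)
  have "0 < x + 1" by (metis less_succ_iff pa_nonneg)
  moreover have "x + 1 \<le> n" using assms(2) x by (metis add.assoc add.commute le_iff_ex)
  ultimately obtain e where e: "d = (x + 1) * e" using assms(3) by blast
  define D where "D = (j + 1) * d"
  \<comment> \<open>Modulo \<open>D + 1\<close> we have \<open>i d + d + 1 = - (j - i) d\<close>, \<open>(j - i) e = d\<close> and \<open>D = - 1\<close>.\<close>
  define u where "u = e * D * ((j + 1) * (j + 1))"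
  define m where "m = (i + 1) * d + 1"
  have M: "D + 1 = m + (x + 1) * d" unfolding D_def m_def x by (simp add: algebra_simps)
  have "(x + 1) * d * u = (x + 1) * e * ((j + 1) * (j + 1)) * d * D" unfolding u_def by (simp add: algebra_simps)
  also have "\<dots> = D * D * D" unfolding e[symmetric] D_def by (simp add: algebra_simps)
  finally have "m * u + D * D * D = (D + 1) * u" unfolding M by (simp only: distrib_right)
  then have "m * u + (D * D + 1) * (D + 1) = 1 + (u + D) * (D + 1)" by (simp add: algebra_simps)
  then show ?thesis unfolding cg_def m_def D_def by blast
qed

section \<open>Coding definable sequences\<close>

definition definable2 :: "('m::pa_model \<Rightarrow> 'm \<Rightarrow> bool) \<Rightarrow> bool" where
  "definable2 p \<longleftrightarrow> (\<exists>P. \<forall>xs s x t y. den from_nat xs s x \<longrightarrow> den from_nat xs t y \<longrightarrow>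
     fden from_nat xs (P s t) (p x y))"

lemma definable2I:
  "(\<And>xs s x t y. den from_nat xs s x \<Longrightarrow> den from_nat xs t y \<Longrightarrow>
     fden from_nat xs (P s t) (p x y)) \<Longrightarrow> definable2 p"
  unfolding definable2_def by blast

text \<open>The moduli have to exceed all entries, so the entries must be bounded before
  \<open>d\<close> can be chosen.\<close>

lemma collection:
  assumes "definable2 g" and ex: "\<And>i. i < n \<Longrightarrow> \<exists>x. g i x"
  shows "\<exists>B. \<forall>i. i < n \<longrightarrow> (\<exists>x. x < B \<and> g i (x::'m::pa_model))"
proof -
  obtain G where G [denI]: "\<And>xs s x t y. den from_nat xs s x \<Longrightarrow> den from_nat xs t y \<Longrightarrow>
     fden from_nat xs (G s t) (g x y)"
    using assms(1) unfolding definable2_def by blast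
  have "n \<le> n \<longrightarrow> (\<exists>B. \<forall>i. i < n \<longrightarrow> (\<exists>x. x < B \<and> g i x))"
  proof (rule pa_induct[of "\<lambda>k. k \<le> n \<longrightarrow> (\<exists>B. \<forall>i. i < k \<longrightarrow> (\<exists>x. x < B \<and> g i x))"])
    show "definable (\<lambda>k. k \<le> n \<longrightarrow> (\<exists>B. \<forall>i. i < k \<longrightarrow> (\<exists>x. x < B \<and> g i x)))"
      by (rule definableI) (assumption | rule denI | rule mono_rules | rule den_element)+
    show "0 \<le> n \<longrightarrow> (\<exists>B. \<forall>i. i < 0 \<longrightarrow> (\<exists>x. x < B \<and> g i x))" by (metis not_le pa_nonneg)
    fix k
    assume IH: "k \<le> n \<longrightarrow> (\<exists>B. \<forall>i. i < k \<longrightarrow> (\<exists>x. x < B \<and> g i x))"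
    show "k + 1 \<le> n \<longrightarrow> (\<exists>B. \<forall>i. i < k + 1 \<longrightarrow> (\<exists>x. x < B \<and> g i x))"
    proof
      assume "k + 1 \<le> n"
      then have "k < n" by (simp add: succ_le_iff)
      then obtain B x where B: "\<And>i. i < k \<Longrightarrow> \<exists>x. x < B \<and> g i x" and x: "g k x"
        using IH ex by (meson less_imp_le)
      have "\<exists>y. y < max B (x + 1) \<and> g i y" if "i < k + 1" for i
      proof (cases "i = k")
        case True
        with x show ?thesis by (metis less_max_iff_disj less_succ_iff order_refl)
      next
        case False
        with that have "i < k" by (simp add: less_succ_iff)
        with B show ?thesis by (metis less_max_iff_disj)
      qed
      then show "\<exists>B. \<forall>i. i < k + 1 \<longrightarrow> (\<exists>x. x < B \<and> g i x)" by blast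
    qed
  qed
  then show ?thesis by simp
qed

text \<open>The Chinese remainder theorem by induction on the number \<open>k\<close> of congruences
  already solved by \<open>c\<close>. The companion \<open>p\<close> is a multiple of the first
  \<open>k\<close> moduli and invertible modulo the remaining ones, so adding a multiple of
  \<open>p\<close> corrects the next residue and preserves the old ones.\<close>

lemma comprehension:
  assumes "definable2 g" and "\<And>i. i < n \<Longrightarrow> \<exists>x. g i x"
  shows "\<exists>c d. \<forall>i. i < n \<longrightarrow> (\<exists>x. nbeta c d i x \<and> g i (x::'m::pa_model))"
proof -
  obtain G where G [denI]: "\<And>xs s x t y. den from_nat xs s x \<Longrightarrow> den from_nat xs t y \<Longrightarrow>
     fden from_nat xs (G s t) (g x y)"
    using assms(1) unfolding definable2_def by blast
  obtain B where B: "\<And>i. i < n \<Longrightarrow> \<exists>x. x < B \<and> g i x" using collection[OF assms] by blast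
  obtain d where d: "B \<le> d" "\<forall>x. 0 < x \<and> x \<le> n \<longrightarrow> (\<exists>e. d = x * e)"
    using common_multiple by blast
  have d_less: "d < (i + 1) * d + 1" for i by (simp add: less_succ_iff distrib_right add_increasing)
  let ?m = "\<lambda>i. (i + 1) * d + 1"
  have "n \<le> n \<longrightarrow> (\<exists>c p. (\<forall>i. i < n \<longrightarrow> (\<exists>q. p = ?m i * q)) \<and>
      (\<forall>j. n \<le> j \<and> j < n \<longrightarrow> (\<exists>u. cg (?m j) (p * u) 1)) \<and>
      (\<forall>i. i < n \<longrightarrow> (\<exists>x. x < ?m i \<and> g i x \<and> cg (?m i) c x)))"
  proof (rule pa_induct[of "\<lambda>k. k \<le> n \<longrightarrow> (\<exists>c p. (\<forall>i. i < k \<longrightarrow> (\<exists>q. p = ?m i * q)) \<and>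
      (\<forall>j. k \<le> j \<and> j < n \<longrightarrow> (\<exists>u. cg (?m j) (p * u) 1)) \<and>
      (\<forall>i. i < k \<longrightarrow> (\<exists>x. x < ?m i \<and> g i x \<and> cg (?m i) c x)))"])
    show "definable (\<lambda>k. k \<le> n \<longrightarrow> (\<exists>c p. (\<forall>i. i < k \<longrightarrow> (\<exists>q. p = ?m i * q)) \<and>
      (\<forall>j. k \<le> j \<and> j < n \<longrightarrow> (\<exists>u. cg (?m j) (p * u) 1)) \<and>
      (\<forall>i. i < k \<longrightarrow> (\<exists>x. x < ?m i \<and> g i x \<and> cg (?m i) c x))))"
      unfolding cg_def
      by (rule definableI) (assumption | rule denI | rule mono_rules | rule den_element)+
    have "cg (?m j) (1 * 1) 1" for j by (simp add: cg_refl)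
    then show "0 \<le> n \<longrightarrow> (\<exists>c p. (\<forall>i. i < 0 \<longrightarrow> (\<exists>q. p = ?m i * q)) \<and>
      (\<forall>j. 0 \<le> j \<and> j < n \<longrightarrow> (\<exists>u. cg (?m j) (p * u) 1)) \<and>
      (\<forall>i. i < 0 \<longrightarrow> (\<exists>x. x < ?m i \<and> g i x \<and> cg (?m i) c x)))"
      by (metis not_le pa_nonneg)
    fix k
    assume IH: "k \<le> n \<longrightarrow> (\<exists>c p. (\<forall>i. i < k \<longrightarrow> (\<exists>q. p = ?m i * q)) \<and>
      (\<forall>j. k \<le> j \<and> j < n \<longrightarrow> (\<exists>u. cg (?m j) (p * u) 1)) \<and>
      (\<forall>i. i < k \<longrightarrow> (\<exists>x. x < ?m i \<and> g i x \<and> cg (?m i) c x)))"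
    show "k + 1 \<le> n \<longrightarrow> (\<exists>c p. (\<forall>i. i < k + 1 \<longrightarrow> (\<exists>q. p = ?m i * q)) \<and>
      (\<forall>j. k + 1 \<le> j \<and> j < n \<longrightarrow> (\<exists>u. cg (?m j) (p * u) 1)) \<and>
      (\<forall>i. i < k + 1 \<longrightarrow> (\<exists>x. x < ?m i \<and> g i x \<and> cg (?m i) c x)))"
    proof
      assume "k + 1 \<le> n"
      then have k: "k < n" by (simp add: succ_le_iff)
      with IH obtain c p where div: "\<And>i. i < k \<Longrightarrow> \<exists>q. p = ?m i * q"
        and inv: "\<And>j. k \<le> j \<Longrightarrow> j < n \<Longrightarrow> \<exists>u. cg (?m j) (p * u) 1"
        and c: "\<And>i. i < k \<Longrightarrow> \<exists>x. x < ?m i \<and> g i x \<and> cg (?m i) c x"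
        by (meson less_imp_le)
      obtain x where x: "x < B" "g k x" using B k by blast
      obtain u where u: "cg (?m k) (p * u) 1" using inv k by blast
      \<comment> \<open>Modulo \<open>?m k\<close> we have p * u = 1 and (k + 1) * d = -1. The new
        value is thus c + (x - c) = x, with the subtraction expressed by a product.\<close>
      let ?c = "c + p * (u * (x + c * ((k + 1) * d)))" and ?p = "p * ?m k"
      have "cg (?m k) (p * u * (x + c * ((k + 1) * d))) (1 * (x + c * ((k + 1) * d)))"
        by (intro cg_mult u cg_refl)
      then have "cg (?m k) ?c (c + (x + c * ((k + 1) * d)))"
        by (intro cg_add cg_refl) (simp add: mult.assoc)
      moreover have "c + (x + c * ((k + 1) * d)) = x + ?m k * c" by (simp add: algebra_simps)
      ultimately have ck: "cg (?m k) ?c x" using cg_trans cg_add_multiple by metis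
      have ci: "cg (?m i) ?c c" if "i < k" for i
      proof -
        obtain q where "p = ?m i * q" using div \<open>i < k\<close> by blast
        then show ?thesis
          using cg_add_multiple[of "?m i" c "q * (u * (x + c * ((k + 1) * d)))"] by (simp only: mult.assoc)
      qed
      have "\<exists>x. x < ?m i \<and> g i x \<and> cg (?m i) ?c x" if "i < k + 1" for i
      proof (cases "i = k")
        case True
        have "x < ?m k" using x(1) d(1) d_less[of k] by order
        with x ck True show ?thesis by blast
      next
        case False
        with that have "i < k" by (simp add: less_succ_iff)
        with c ci show ?thesis using cg_trans by blast
      qed
      moreover have "\<exists>q. ?p = ?m i * q" if "i < k + 1" for i
      proof (cases "i = k")
        case True
        then show ?thesis by (metis mult.commute)
      next
        case False
        with that have "i < k" by (simp add: less_succ_iff)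
        with div show ?thesis by (metis mult.assoc)
      qed
      moreover have "\<exists>u. cg (?m j) (?p * u) 1" if j: "k + 1 \<le> j" "j < n" for j
      proof -
        have "k < j" using j(1) by (simp add: succ_le_iff)
        then obtain v where v: "cg (?m j) (?m k * v) 1"
          using beta_moduli_coprime[of k j n d] d(2) less_imp_le[OF j(2)] by blast
        obtain w where w: "cg (?m j) (p * w) 1" using inv[OF less_imp_le[OF \<open>k < j\<close>] j(2)] by blast
        have "cg (?m j) (p * w * (?m k * v)) (1 * 1)" by (intro cg_mult v w)
        then have "cg (?m j) (?p * (w * v)) 1" by (simp only: mult_1 mult.assoc mult.left_commute)
        then show ?thesis by blast
      qed
      ultimately show "\<exists>c p. (\<forall>i. i < k + 1 \<longrightarrow> (\<exists>q. p = ?m i * q)) \<and>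
        (\<forall>j. k + 1 \<le> j \<and> j < n \<longrightarrow> (\<exists>u. cg (?m j) (p * u) 1)) \<and>
        (\<forall>i. i < k + 1 \<longrightarrow> (\<exists>x. x < ?m i \<and> g i x \<and> cg (?m i) c x))" by blast
    qed
  qed
  then obtain c where "\<And>i. i < n \<Longrightarrow> \<exists>x. x < ?m i \<and> g i x \<and> cg (?m i) c x" by blast
  then have "\<forall>i. i < n \<longrightarrow> (\<exists>x. nbeta c d i x \<and> g i x)" using nbeta_cg by blast
  then show ?thesis by blast
qed

section \<open>Coded derivations\<close>

definition Derivable :: "(('m::pa_model \<Rightarrow> bool) \<Rightarrow> 'm \<Rightarrow> bool) \<Rightarrow> 'm \<Rightarrow> bool" where
  "Derivable R z \<longleftrightarrow> (\<exists>c d n. nbeta c d n z \<and>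
     (\<forall>i x. i \<le> n \<and> nbeta c d i x \<longrightarrow> R (\<lambda>y. \<exists>j. j < i \<and> nbeta c d j y) x))"

lemma fden_derivable:
  assumes R: "\<And>ys X Y s x. pden b ys X Y \<Longrightarrow> den b ys s x \<Longrightarrow> fden b ys (R X s) (R' Y x)"
    and "den b xs s x"
  shows "fden b xs (derivable R s) (Derivable R' x)"
proof -
  have "pden b ys (\<lambda>y. \<^bold>\<exists>j. j \<^bold>< i \<^bold>\<and> beta c d j y) (\<lambda>y. \<exists>j. j < i' \<and> nbeta c' d' j y)"
    if "den b ys i i'" "den b ys c c'" "den b ys d d'" for ys i i' c c' d d'
    using that by - (rule pdenI, (assumption | rule denI | rule mono_rules)+)
  note [denI] = this R
  show ?thesis
    unfolding derivable_def Derivable_def using assms(2)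
    by - (assumption | rule denI | rule mono_rules)+
qed

text \<open>Complete induction on the position in the coded sequence. The length may be nonstandard,
  so \<open>P\<close> has to be definable. Initial segments are derivations too, which makes the
  premises derivable.\<close>

lemma Derivable_induct [consumes 1, case_names definable mono step]:
  assumes z: "Derivable R z" and P: "definable P" and R: "mono R"
    and step: "\<And>x. R (\<lambda>y. Derivable R y \<and> P y) x \<Longrightarrow> P x"
  shows "P z"
proof -
  obtain c d n where n: "nbeta c d n z"
    and *: "\<And>i x. i \<le> n \<Longrightarrow> nbeta c d i x \<Longrightarrow> R (\<lambda>y. \<exists>j. j < i \<and> nbeta c d j y) x"
    using z unfolding Derivable_def by blast
  obtain Q where [denI]: "\<And>xs s x. den from_nat xs s x \<Longrightarrow> fden from_nat xs (Q s) (P x)"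
    using definableD[OF P] by blast
  have "n \<le> n \<longrightarrow> (\<forall>x. nbeta c d n x \<longrightarrow> P x)"
  proof (rule pa_less_induct[of "\<lambda>i. i \<le> n \<longrightarrow> (\<forall>x. nbeta c d i x \<longrightarrow> P x)"])
    show "definable (\<lambda>i. i \<le> n \<longrightarrow> (\<forall>x. nbeta c d i x \<longrightarrow> P x))"
      by (rule definableI) (assumption | rule denI | rule mono_rules | rule den_element)+
    fix i
    assume IH: "\<And>j. j < i \<Longrightarrow> j \<le> n \<longrightarrow> (\<forall>x. nbeta c d j x \<longrightarrow> P x)"
    show "i \<le> n \<longrightarrow> (\<forall>x. nbeta c d i x \<longrightarrow> P x)"
    proof (intro impI allI)
      fix x
      assume i: "i \<le> n" and x: "nbeta c d i x"
      have "(\<lambda>y. \<exists>j. j < i \<and> nbeta c d j y) \<le> (\<lambda>y. Derivable R y \<and> P y)"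
      proof (rule predicate1I, elim exE conjE)
        fix y j
        assume j: "j < i" "nbeta c d j y"
        with i have "j \<le> n" by simp
        moreover have "R (\<lambda>y. \<exists>j. j < k \<and> nbeta c d j y) x" if "k \<le> j" "nbeta c d k x" for k x
          using * that \<open>j \<le> n\<close> by simp
        then have "Derivable R y" unfolding Derivable_def using j(2) by blast
        ultimately show "Derivable R y \<and> P y" using IH j by blast
      qed
      then have "R (\<lambda>y. \<exists>j. j < i \<and> nbeta c d j y) x \<longrightarrow> R (\<lambda>y. Derivable R y \<and> P y) x"
        using monoD[OF R] by (simp add: le_fun_def)
      then show "P x" using *[OF i x] step by blast
    qed
  qed
  with n show ?thesis by blast
qed

lemma Derivable_axiom:
  assumes "mono R" and z: "R (\<lambda>_. False) z"
  shows "Derivable R z"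
proof -
  have "definable2 (\<lambda>i x. x = z)"
    by (rule definable2I) (assumption | rule denI | rule mono_rules | rule den_element)+
  then obtain c d where "nbeta c d 0 z"
    using comprehension[of "\<lambda>i x. x = z" 1] zero_less_one by blast
  moreover have "R X z" for X
    using monoD[OF assms(1), of "\<lambda>_. False" X] z by (simp add: le_fun_def)
  ultimately show ?thesis
    unfolding Derivable_def using nbeta_unique by (metis pa_le_0_iff)
qed

text \<open>
  All rules in question have at most two premises, so that a derivation of the conclusion is
  the concatenation of two derivations with the conclusion appended.
\<close>

lemma Derivable_rule:
  assumes R: "mono R" and "Derivable R y" "Derivable R y'"
    and z: "R (\<lambda>x. x = y \<or> x = y') z"
  shows "Derivable R z"
proof -
  obtain c d n where n: "nbeta c d n y"
    and *: "\<And>i x. i \<le> n \<Longrightarrow> nbeta c d i x \<Longrightarrow> R (\<lambda>y. \<exists>j. j < i \<and> nbeta c d j y) x"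
    using assms(2) unfolding Derivable_def by blast
  obtain c' d' n' where n': "nbeta c' d' n' y'"
    and step': "\<And>i x. i \<le> n' \<Longrightarrow> nbeta c' d' i x \<Longrightarrow> R (\<lambda>y. \<exists>j. j < i \<and> nbeta c' d' j y) x"
    using assms(3) unfolding Derivable_def by blast
  define m where "m = n + 1 + n' + 1"
  define g where "g i x \<longleftrightarrow> (i \<le> n \<and> nbeta c d i x) \<or>
    (\<exists>k. i = n + 1 + k \<and> k \<le> n' \<and> nbeta c' d' k x) \<or> (i = m \<and> x = z)" for i x
  have "definable2 g"
    unfolding g_def
    by (rule definable2I) (assumption | rule denI | rule mono_rules | rule den_element)+
  have cases: "i \<le> n \<or> (\<exists>k. i = n + 1 + k \<and> k \<le> n') \<or> i = m" if "i \<le> m" for i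
  proof (cases "i \<le> n")
    case False
    then obtain k where k: "i = n + 1 + k" by (metis less_iff_ex not_le)
    with that have "n + 1 + k \<le> n + 1 + (n' + 1)" unfolding m_def by (simp only: add.assoc)
    then have "k \<le> n' + 1" by (rule add_le_imp_le_left)
    then consider "k \<le> n'" | "k = n' + 1" by (metis less_succ_iff order.order_iff_strict)
    with k show ?thesis unfolding m_def by cases (auto simp: add.assoc)
  qed simp
  have "\<exists>x. g i x" if "i < m + 1" for i
    using cases[of i] that nbeta_ex unfolding g_def less_succ_iff by blast
  then obtain C D where CD: "\<And>i. i < m + 1 \<Longrightarrow> \<exists>x. nbeta C D i x \<and> g i x"
    using comprehension[OF \<open>definable2 g\<close>] by blast
  have CD_g: "g i x" if "i \<le> m" "nbeta C D i x" for i x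
    using CD[of i] that nbeta_unique unfolding less_succ_iff by blast
  have n_less: "n < n + 1 + k" for k by (auto simp: less_iff_ex)
  have less_m: "n + 1 + k < m" if "k \<le> n'" for k
    using that unfolding m_def less_succ_iff by simp
  have n_less_m: "i < m" if "i \<le> n" for i
    using le_less_trans[OF that n_less[of "n' + 1"]] unfolding m_def by (simp only: add.assoc)
  have excl: "i \<le> n \<Longrightarrow> i \<noteq> n + 1 + k" "i \<le> n \<Longrightarrow> i \<noteq> m" "k \<le> n' \<Longrightarrow> n + 1 + k \<noteq> m" for i k
    using n_less[of k] n_less_m[of i] less_m[of k] by auto
  \<comment> \<open>Comprehension promises at each position some entry related by \<open>g\<close>.
    Uniqueness identifies it with the intended entry of the concatenation.\<close>
  have g_unique: "x = x'" if "g i x" "g i x'" for i x x'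
    using that unfolding g_def
    by (elim disjE exE conjE) (use excl nbeta_unique in \<open>simp_all, blast+\<close>)
  have g_CD: "nbeta C D i x" if i: "i \<le> m" and x: "g i x" for i x
  proof -
    obtain x' where x': "nbeta C D i x'" "g i x'" using CD[of i] i unfolding less_succ_iff by blast
    with x have "x = x'" by (blast intro: g_unique)
    with x' show ?thesis by simp
  qed
  have weaken: "R Y x" if "R X x" "\<And>y. X y \<Longrightarrow> Y y" for X Y x
    using monoD[OF R, of X Y] that by (auto simp: le_fun_def)
  have "R (\<lambda>y. \<exists>j. j < i \<and> nbeta C D j y) x" if i: "i \<le> m" and x: "nbeta C D i x" for i x
  proof -
    from CD_g[OF i x] consider (1) "i \<le> n" "nbeta c d i x"
      | (2) k where "i = n + 1 + k" "k \<le> n'" "nbeta c' d' k x" | (3) "i = m" "x = z"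
      unfolding g_def by blast
    then show ?thesis
    proof cases
      case 1
      have "nbeta C D j y" if "j < i" "nbeta c d j y" for j y
      proof -
        have "j \<le> n" using that(1) 1(1) by simp
        then show ?thesis using that n_less_m by (intro g_CD) (auto simp: g_def intro: less_imp_le)
      qed
      then show ?thesis by (intro weaken[OF *[OF 1]]) blast
    next
      case 2
      have "nbeta C D (n + 1 + j) y" if "j < k" "nbeta c' d' j y" for j y
      proof -
        have "j \<le> n'" using that(1) 2(2) by simp
        then show ?thesis using that less_m by (intro g_CD) (auto simp: g_def intro: less_imp_le)
      qed
      then show ?thesis
        using 2(1) by (intro weaken[OF step'[OF 2(2,3)]]) (blast intro: add_strict_left_mono)
    next
      case 3
      have "nbeta C D n y"
        using n n_less_m[of n] by (intro g_CD) (auto simp: g_def intro: less_imp_le)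
      moreover have "nbeta C D (n + 1 + n') y'"
        using n' less_m[of n'] by (intro g_CD) (auto simp: g_def intro: less_imp_le)
      ultimately show ?thesis
        unfolding 3 using n_less_m[of n] less_m[of n'] by (intro weaken[OF z]) blast
    qed
  qed
  moreover have "nbeta C D m z" by (rule g_CD) (auto simp: g_def)
  ultimately show ?thesis unfolding Derivable_def by blast
qed

lemma Derivable_rule1:
  "mono R \<Longrightarrow> Derivable R y \<Longrightarrow> R (\<lambda>x. x = y) z \<Longrightarrow> Derivable R z"
  using Derivable_rule[of R y y z] by simp


section \<open>Ordinals in models of PA\<close>

definition nocons :: "'m::pa_model \<Rightarrow> 'm \<Rightarrow> 'm \<Rightarrow> 'm" where
  "nocons a k b = ncons (npair a k) b"

lemma nocons_simps [simp]:
  "nocons a k b = nocons a' k' b' \<longleftrightarrow> a = a' \<and> k = k' \<and> b = b'"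
  "nocons a k b \<noteq> 0" "0 \<noteq> nocons a k b"
  by (auto simp: nocons_def)

lemma den_ocons [denI]:
  "den b xs s x \<Longrightarrow> den b xs t y \<Longrightarrow> den b xs u z \<Longrightarrow> den b xs (ocons s t u) (nocons x y z)"
  unfolding ocons_def nocons_def by (assumption | rule denI)+

definition oless_step :: "('m::pa_model \<Rightarrow> bool) \<Rightarrow> 'm \<Rightarrow> bool" where
  "oless_step X x \<longleftrightarrow>
     (\<exists>a k b. x = npair 0 (nocons a k b)) \<or>
     (\<exists>a k b a' k' b'. x = npair (nocons a k b) (nocons a' k' b') \<and>
        (X (npair a a') \<or> a = a' \<and> k < k' \<or> a = a' \<and> k = k' \<and> X (npair b b')))"

definition noless :: "'m::pa_model \<Rightarrow> 'm \<Rightarrow> bool" where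
  "noless u v \<longleftrightarrow> Derivable oless_step (npair u v)"

lemma fden_oless [denI]:
  "den b xs s x \<Longrightarrow> den b xs t y \<Longrightarrow> fden b xs (oless s t) (noless x y)"
  unfolding oless_def noless_def
proof (rule fden_derivable)
  fix ys X Y s x
  assume "pden b ys X Y" "den b ys s x"
  note [denI] = pdenD[where P = X and p = Y]
  show "fden b ys ((\<^bold>\<exists>a. \<^bold>\<exists>k. \<^bold>\<exists>b. s \<^bold>= pair (num 0) (ocons a k b)) \<^bold>\<or>
       (\<^bold>\<exists>a. \<^bold>\<exists>k. \<^bold>\<exists>b. \<^bold>\<exists>a'. \<^bold>\<exists>k'. \<^bold>\<exists>b'.
          s \<^bold>= pair (ocons a k b) (ocons a' k' b') \<^bold>\<and>
          (X (pair a a') \<^bold>\<or> a \<^bold>= a' \<^bold>\<and> k \<^bold>< k' \<^bold>\<or>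
           a \<^bold>= a' \<^bold>\<and> k \<^bold>= k' \<^bold>\<and> X (pair b b')))) (oless_step Y x)"
    unfolding oless_step_def using \<open>pden b ys X Y\<close> \<open>den b ys s x\<close>
    by - (assumption | rule denI | rule mono_rules)+
qed (assumption | rule denI)+

lemma mono_oless_step: "mono oless_step"
  by (rule monoI) (unfold oless_step_def le_fun_def le_bool_def, blast)

lemma noless_0: "noless 0 (nocons a k b)"
  unfolding noless_def
  by (rule Derivable_axiom[OF mono_oless_step]) (auto simp: oless_step_def)

lemma noless_exponent: "noless a a' \<Longrightarrow> noless (nocons a k b) (nocons a' k' b')"
  unfolding noless_def
  by (erule Derivable_rule1[OF mono_oless_step]) (auto simp: oless_step_def)

lemma noless_coefficient: "k < k' \<Longrightarrow> noless (nocons a k b) (nocons a k' b')"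
  unfolding noless_def
  by (rule Derivable_axiom[OF mono_oless_step]) (auto simp: oless_step_def)

definition ord_step :: "('m::pa_model \<Rightarrow> bool) \<Rightarrow> 'm \<Rightarrow> bool" where
  "ord_step X x \<longleftrightarrow> x = 0 \<or>
     (\<exists>a k b. x = nocons a k b \<and> 0 < k \<and> X a \<and> X b \<and>
        (\<forall>a' k' b'. b = nocons a' k' b' \<longrightarrow> noless a' a))"

definition nord :: "'m::pa_model \<Rightarrow> bool" where
  "nord u \<longleftrightarrow> Derivable ord_step u"

lemma fden_is_ord [denI]: "den b xs s x \<Longrightarrow> fden b xs (is_ord s) (nord x)"
  unfolding is_ord_def nord_def
proof (rule fden_derivable)
  fix ys X Y s x
  assume "pden b ys X Y" "den b ys s x"
  note [denI] = pdenD[where P = X and p = Y]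
  show "fden b ys (s \<^bold>= num 0 \<^bold>\<or>
       (\<^bold>\<exists>a. \<^bold>\<exists>k. \<^bold>\<exists>b.
          s \<^bold>= ocons a k b \<^bold>\<and> num 0 \<^bold>< k \<^bold>\<and> X a \<^bold>\<and> X b \<^bold>\<and>
          (\<^bold>\<forall>a'. \<^bold>\<forall>k'. \<^bold>\<forall>b'. b \<^bold>= ocons a' k' b' \<^bold>\<longrightarrow> oless a' a))) (ord_step Y x)"
    unfolding ord_step_def using \<open>pden b ys X Y\<close> \<open>den b ys s x\<close>
    by - (assumption | rule denI | rule mono_rules)+
qed (assumption | rule denI)+

lemma mono_ord_step: "mono ord_step"
  by (rule monoI) (unfold ord_step_def le_fun_def le_bool_def, blast)

lemma nord_0: "nord 0"
  unfolding nord_def by (rule Derivable_axiom[OF mono_ord_step]) (auto simp: ord_step_def)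

lemma nord_monomial: "nord a \<Longrightarrow> 0 < k \<Longrightarrow> nord (nocons a k 0)"
  unfolding nord_def
  by (rule Derivable_rule[OF mono_ord_step _ nord_0[unfolded nord_def], of a]) (auto simp: ord_step_def)

text \<open>Induction along leading exponents, the path that a tower has to dominate.\<close>

lemma nord_induct [consumes 1, case_names definable zero exponent]:
  assumes "nord u" "definable P" "P 0" "\<And>a k b. P a \<Longrightarrow> P (nocons a k b)"
  shows "P u"
  using assms(1)[unfolded nord_def] assms(2) mono_ord_step
  by (rule Derivable_induct) (use assms(3,4) in \<open>auto simp: ord_step_def\<close>)

lemma fden_is_max [denI]:
  assumes "den b xs m x" "den b xs s y" "den b xs t z"
  shows "fden b xs (is_max m s t) (x = max y (z::'m::pa_model))"
proof -
  have "x = max y z \<longleftrightarrow> (y \<le> z \<and> x = z) \<or> (z \<le> y \<and> x = y)" by (auto simp: max_def)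
  then show ?thesis
    unfolding is_max_def using assms by (simp only:) (assumption | rule denI | rule mono_rules)+
qed

definition len_step :: "('m::pa_model \<Rightarrow> bool) \<Rightarrow> 'm \<Rightarrow> bool" where
  "len_step X x \<longleftrightarrow> x = npair 0 0 \<or>
     (\<exists>a k b p q r s. x = npair (nocons a k b) s \<and> X (npair a p) \<and> X (npair b q) \<and>
        r = max (p + 1) k \<and> s = max r q)"

definition nlen_max :: "'m::pa_model \<Rightarrow> 'm \<Rightarrow> bool" where
  "nlen_max u m \<longleftrightarrow> Derivable len_step (npair u m)"

lemma fden_is_olen_max [denI]:
  "den b xs s x \<Longrightarrow> den b xs t y \<Longrightarrow> fden b xs (is_olen_max s t) (nlen_max x y)"
  unfolding is_olen_max_def nlen_max_def
proof (rule fden_derivable)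
  fix ys X Y x x'
  assume "pden b ys X Y" "den b ys x x'"
  note [denI] = pdenD[where P = X and p = Y]
  show "fden b ys (x \<^bold>= pair (num 0) (num 0) \<^bold>\<or>
       (\<^bold>\<exists>a. \<^bold>\<exists>k. \<^bold>\<exists>b. \<^bold>\<exists>p. \<^bold>\<exists>q. \<^bold>\<exists>r. \<^bold>\<exists>s.
          x \<^bold>= pair (ocons a k b) s \<^bold>\<and> X (pair a p) \<^bold>\<and> X (pair b q) \<^bold>\<and>
          is_max r (\<^bold>S p) k \<^bold>\<and> is_max s r q)) (len_step Y x')"
    unfolding len_step_def using \<open>pden b ys X Y\<close> \<open>den b ys x x'\<close>
    by - (assumption | rule denI | rule mono_rules)+
qed (assumption | rule denI)+

lemma mono_len_step: "mono len_step"
  by (rule monoI) (unfold len_step_def le_fun_def le_bool_def, blast)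

definition ko_step :: "('m::pa_model \<Rightarrow> bool) \<Rightarrow> 'm \<Rightarrow> bool" where
  "ko_step X x \<longleftrightarrow> x = npair 0 0 \<or>
     (\<exists>a k b p q r s. x = npair (nocons a k b) s \<and> X (npair a p) \<and> X (npair b q) \<and>
        r = max p k \<and> s = max r q)"

definition nko :: "'m::pa_model \<Rightarrow> 'm \<Rightarrow> bool" where
  "nko u m \<longleftrightarrow> Derivable ko_step (npair u m)"

lemma fden_is_ko [denI]:
  "den b xs s x \<Longrightarrow> den b xs t y \<Longrightarrow> fden b xs (is_ko s t) (nko x y)"
  unfolding is_ko_def nko_def
proof (rule fden_derivable)
  fix ys X Y x x'
  assume "pden b ys X Y" "den b ys x x'"
  note [denI] = pdenD[where P = X and p = Y]
  show "fden b ys (x \<^bold>= pair (num 0) (num 0) \<^bold>\<or>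
       (\<^bold>\<exists>a. \<^bold>\<exists>k. \<^bold>\<exists>b. \<^bold>\<exists>p. \<^bold>\<exists>q. \<^bold>\<exists>r. \<^bold>\<exists>s.
          x \<^bold>= pair (ocons a k b) s \<^bold>\<and> X (pair a p) \<^bold>\<and> X (pair b q) \<^bold>\<and>
          is_max r p k \<^bold>\<and> is_max s r q)) (ko_step Y x')"
    unfolding ko_step_def using \<open>pden b ys X Y\<close> \<open>den b ys x x'\<close>
    by - (assumption | rule denI | rule mono_rules)+
qed (assumption | rule denI)+

lemma mono_ko_step: "mono ko_step"
  by (rule monoI) (unfold ko_step_def le_fun_def le_bool_def, blast)

lemma nko_0: "nko 0 0"
  unfolding nko_def by (rule Derivable_axiom[OF mono_ko_step]) (auto simp: ko_step_def)

lemma nko_nocons: "nko a p \<Longrightarrow> nko b q \<Longrightarrow> nko (nocons a k b) (max (max p k) q)"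
  unfolding nko_def
  by (rule Derivable_rule[OF mono_ko_step, of "npair a p" "npair b q"]) (auto simp: ko_step_def)

lemma nko_monomial: "nko a p \<Longrightarrow> nko (nocons a k 0) (max p k)"
  using nko_nocons[OF _ nko_0, of a p k] by (simp add: max_def)

text \<open>Both values come from the same recursion, except that the length adds 1 at each
  exponent. Induction on the derivation of the length also yields the existence of a value of
  \<open>nko\<close>.\<close>

lemma nlen_max_nko:
  assumes "nlen_max u m"
  shows "\<exists>p. p \<le> m \<and> nko u p"
proof -
  have "\<forall>v l. npair u m = npair v l \<longrightarrow> (\<exists>p. p \<le> l \<and> nko v p)"
    using assms[unfolded nlen_max_def]
  proof (induction rule: Derivable_induct)
    case definable
    show ?case by (rule definableI) (assumption | rule denI | rule mono_rules | rule den_element)+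
  next
    case (step x)
    show ?case
    proof (intro allI impI)
      fix v l
      assume x: "x = npair v l"
      from step consider "v = 0" "l = 0" | a k b p q where "v = nocons a k b"
        "l = max (max (p + 1) k) q" "\<exists>p'. p' \<le> p \<and> nko a p'" "\<exists>q'. q' \<le> q \<and> nko b q'"
        unfolding x len_step_def npair_eq_iff by blast
      then show "\<exists>p. p \<le> l \<and> nko v p"
      proof cases
        case 1
        then show ?thesis using nko_0 by blast
      next
        case 2
        then obtain p' q' where p': "p' \<le> p" "nko a p'" and q': "q' \<le> q" "nko b q'" by blast
        have "p' \<le> p + 1" using p'(1) by (metis less_imp_le less_succ_iff)
        then have "max (max p' k) q' \<le> l"
          using q'(1) unfolding 2(2) by (intro max.mono order_refl)
        then show ?thesis using nko_nocons[OF p'(2) q'(2)] 2(1) by blast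
      qed
    qed
  qed (rule mono_len_step)
  then show ?thesis by blast
qed


section \<open>Primitive recursive functions in models of PA\<close>

definition npr_zero :: "'m::pa_model" where "npr_zero = npair 0 0"
definition npr_succ :: "'m::pa_model" where "npr_succ = npair 1 0"
definition npr_proj :: "'m::pa_model \<Rightarrow> 'm" where "npr_proj i = npair 2 i"
definition npr_comp :: "'m::pa_model \<Rightarrow> 'm \<Rightarrow> 'm" where "npr_comp f gs = npair 3 (npair f gs)"
definition npr_rec :: "'m::pa_model \<Rightarrow> 'm \<Rightarrow> 'm" where "npr_rec f g = npair 4 (npair f g)"
definition njfun :: "'m::pa_model \<Rightarrow> 'm \<Rightarrow> 'm" where "njfun n e = npair 0 (npair n e)"
definition njfuns :: "'m::pa_model \<Rightarrow> 'm \<Rightarrow> 'm \<Rightarrow> 'm" where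
  "njfuns m n es = npair 1 (npair m (npair n es))"
definition njval :: "'m::pa_model \<Rightarrow> 'm \<Rightarrow> 'm \<Rightarrow> 'm" where
  "njval e xs y = npair 0 (npair e (npair xs y))"
definition njvals :: "'m::pa_model \<Rightarrow> 'm \<Rightarrow> 'm \<Rightarrow> 'm" where
  "njvals es xs ys = npair 1 (npair es (npair xs ys))"

lemma den_pr_zero [denI]: "den b ws pr_zero npr_zero"
  unfolding pr_zero_def npr_zero_def by (assumption | rule denI)+

lemma den_pr_succ [denI]: "den b ws pr_succ npr_succ"
  unfolding pr_succ_def npr_succ_def by (assumption | rule denI)+

lemma den_pr_proj [denI]: "den b ws s x \<Longrightarrow> den b ws (pr_proj s) (npr_proj x)"
  unfolding pr_proj_def npr_proj_def by (assumption | rule denI)+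

lemma den_pr_comp [denI]:
  "den b ws s x \<Longrightarrow> den b ws t y \<Longrightarrow> den b ws (pr_comp s t) (npr_comp x y)"
  unfolding pr_comp_def npr_comp_def by (assumption | rule denI)+

lemma den_pr_rec [denI]:
  "den b ws s x \<Longrightarrow> den b ws t y \<Longrightarrow> den b ws (pr_rec s t) (npr_rec x y)"
  unfolding pr_rec_def npr_rec_def by (assumption | rule denI)+

lemma den_jfun [denI]:
  "den b ws s x \<Longrightarrow> den b ws t y \<Longrightarrow> den b ws (jfun s t) (njfun x y)"
  unfolding jfun_def njfun_def by (assumption | rule denI)+

lemma den_jfuns [denI]:
  "den b ws s x \<Longrightarrow> den b ws t y \<Longrightarrow> den b ws u z \<Longrightarrow> den b ws (jfuns s t u) (njfuns x y z)"
  unfolding jfuns_def njfuns_def by (assumption | rule denI)+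

lemma den_jval [denI]:
  "den b ws s x \<Longrightarrow> den b ws t y \<Longrightarrow> den b ws u z \<Longrightarrow> den b ws (jval s t u) (njval x y z)"
  unfolding jval_def njval_def by (assumption | rule denI)+

lemma den_jvals [denI]:
  "den b ws s x \<Longrightarrow> den b ws t y \<Longrightarrow> den b ws u z \<Longrightarrow> den b ws (jvals s t u) (njvals x y z)"
  unfolding jvals_def njvals_def by (assumption | rule denI)+

definition pr_step :: "('m::pa_model \<Rightarrow> bool) \<Rightarrow> 'm \<Rightarrow> bool" where
  "pr_step X x \<longleftrightarrow>
     (\<exists>n. x = njfun n npr_zero) \<or>
     x = njfun 1 npr_succ \<or>
     (\<exists>n i. x = njfun n (npr_proj i) \<and> i < n) \<or>
     (\<exists>m n f gs. x = njfun n (npr_comp f gs) \<and> X (njfun m f) \<and> X (njfuns m n gs)) \<or>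
     (\<exists>n f g. x = njfun (n + 1) (npr_rec f g) \<and> X (njfun n f) \<and> X (njfun (n + 1 + 1) g)) \<or>
     (\<exists>n. x = njfuns 0 n 0) \<or>
     (\<exists>m n g gs. x = njfuns (m + 1) n (ncons g gs) \<and> X (njfun n g) \<and> X (njfuns m n gs))"

definition nfun :: "'m::pa_model \<Rightarrow> 'm \<Rightarrow> bool" where
  "nfun n e \<longleftrightarrow> Derivable pr_step (njfun n e)"

definition nfuns :: "'m::pa_model \<Rightarrow> 'm \<Rightarrow> 'm \<Rightarrow> bool" where
  "nfuns m n es \<longleftrightarrow> Derivable pr_step (njfuns m n es)"

lemma fden_is_pr [denI]:
  "den b ws s x \<Longrightarrow> den b ws t y \<Longrightarrow> fden b ws (is_pr s t) (nfun x y)"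
  unfolding is_pr_def nfun_def
proof (rule fden_derivable)
  fix ys X Y x x'
  assume "pden b ys X Y" "den b ys x x'"
  note [denI] = pdenD[where P = X and p = Y]
  show "fden b ys ((\<^bold>\<exists>n. x \<^bold>= jfun n pr_zero) \<^bold>\<or>
       x \<^bold>= jfun (num 1) pr_succ \<^bold>\<or>
       (\<^bold>\<exists>n. \<^bold>\<exists>i. x \<^bold>= jfun n (pr_proj i) \<^bold>\<and> i \<^bold>< n) \<^bold>\<or>
       (\<^bold>\<exists>m. \<^bold>\<exists>n. \<^bold>\<exists>f. \<^bold>\<exists>gs.
          x \<^bold>= jfun n (pr_comp f gs) \<^bold>\<and> X (jfun m f) \<^bold>\<and> X (jfuns m n gs)) \<^bold>\<or>
       (\<^bold>\<exists>n. \<^bold>\<exists>f. \<^bold>\<exists>g.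
          x \<^bold>= jfun (\<^bold>S n) (pr_rec f g) \<^bold>\<and> X (jfun n f) \<^bold>\<and> X (jfun (\<^bold>S (\<^bold>S n)) g)) \<^bold>\<or>
       (\<^bold>\<exists>n. x \<^bold>= jfuns (num 0) n (num 0)) \<^bold>\<or>
       (\<^bold>\<exists>m. \<^bold>\<exists>n. \<^bold>\<exists>g. \<^bold>\<exists>gs.
          x \<^bold>= jfuns (\<^bold>S m) n (cons g gs) \<^bold>\<and> X (jfun n g) \<^bold>\<and> X (jfuns m n gs))) (pr_step Y x')"
    unfolding pr_step_def using \<open>pden b ys X Y\<close> \<open>den b ys x x'\<close>
    by - (assumption | rule denI | rule mono_rules)+
qed (assumption | rule denI)+

lemma mono_pr_step: "mono pr_step"
  unfolding pr_step_def
  by (rule monoI, rule predicate1I)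
    (erule disj_forward ex_forward conj_forward | assumption | erule (1) predicate1D)+

lemmas pr_step_defs = pr_step_def njfun_def njfuns_def npr_proj_def

lemma nfun_zero: "nfun n npr_zero"
  unfolding nfun_def by (rule Derivable_axiom[OF mono_pr_step]) (simp add: pr_step_defs)

lemma nfun_succ: "nfun 1 npr_succ"
  unfolding nfun_def by (rule Derivable_axiom[OF mono_pr_step]) (simp add: pr_step_defs)

lemma nfun_proj: "i < n \<Longrightarrow> nfun n (npr_proj i)"
  unfolding nfun_def by (rule Derivable_axiom[OF mono_pr_step]) (simp add: pr_step_defs)

lemma nfun_comp: "nfun m f \<Longrightarrow> nfuns m n gs \<Longrightarrow> nfun n (npr_comp f gs)"
  unfolding nfun_def nfuns_def
  by (erule (1) Derivable_rule[OF mono_pr_step]) (simp_all add: pr_step_defs)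

lemma nfun_rec: "nfun n f \<Longrightarrow> nfun (n + 1 + 1) g \<Longrightarrow> nfun (n + 1) (npr_rec f g)"
  unfolding nfun_def
  by (erule (1) Derivable_rule[OF mono_pr_step]) (simp add: pr_step_defs, blast)

lemma nfuns_Nil: "nfuns 0 n 0"
  unfolding nfuns_def by (rule Derivable_axiom[OF mono_pr_step]) (simp add: pr_step_defs)

lemma nfuns_Cons: "nfun n g \<Longrightarrow> nfuns m n gs \<Longrightarrow> nfuns (m + 1) n (ncons g gs)"
  unfolding nfun_def nfuns_def
  by (erule (1) Derivable_rule[OF mono_pr_step]) (simp_all add: pr_step_defs)

definition val_step :: "('m::pa_model \<Rightarrow> bool) \<Rightarrow> 'm \<Rightarrow> bool" where
  "val_step X x \<longleftrightarrow>
     (\<exists>xs. x = njval npr_zero xs 0) \<or>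
     (\<exists>n. x = njval npr_succ (ncons n 0) (n + 1)) \<or>
     (\<exists>n xs. x = njval (npr_proj 0) (ncons n xs) n) \<or>
     (\<exists>i n xs y. x = njval (npr_proj (i + 1)) (ncons n xs) y \<and> X (njval (npr_proj i) xs y)) \<or>
     (\<exists>f gs xs ys z. x = njval (npr_comp f gs) xs z \<and> X (njvals gs xs ys) \<and> X (njval f ys z)) \<or>
     (\<exists>f g xs y. x = njval (npr_rec f g) (ncons 0 xs) y \<and> X (njval f xs y)) \<or>
     (\<exists>f g n xs y z. x = njval (npr_rec f g) (ncons (n + 1) xs) z \<and>
        X (njval (npr_rec f g) (ncons n xs) y) \<and> X (njval g (ncons n (ncons y xs)) z)) \<or>
     (\<exists>xs. x = njvals 0 xs 0) \<or>
     (\<exists>g gs xs y ys. x = njvals (ncons g gs) xs (ncons y ys) \<and> X (njval g xs y) \<and> X (njvals gs xs ys))"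

definition nval :: "'m::pa_model \<Rightarrow> 'm \<Rightarrow> 'm \<Rightarrow> bool" where
  "nval e xs y \<longleftrightarrow> Derivable val_step (njval e xs y)"

definition nvals :: "'m::pa_model \<Rightarrow> 'm \<Rightarrow> 'm \<Rightarrow> bool" where
  "nvals es xs ys \<longleftrightarrow> Derivable val_step (njvals es xs ys)"

lemma fden_pr_val [denI]:
  "den b ws s x \<Longrightarrow> den b ws t y \<Longrightarrow> den b ws u z \<Longrightarrow> fden b ws (pr_val s t u) (nval x y z)"
  unfolding pr_val_def nval_def
proof (rule fden_derivable)
  fix ys X Y x x'
  assume "pden b ys X Y" "den b ys x x'"
  note [denI] = pdenD[where P = X and p = Y]
  show "fden b ys ((\<^bold>\<exists>xs. x \<^bold>= jval pr_zero xs (num 0)) \<^bold>\<or>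
       (\<^bold>\<exists>n. x \<^bold>= jval pr_succ (cons n (num 0)) (\<^bold>S n)) \<^bold>\<or>
       (\<^bold>\<exists>n. \<^bold>\<exists>xs. x \<^bold>= jval (pr_proj (num 0)) (cons n xs) n) \<^bold>\<or>
       (\<^bold>\<exists>i. \<^bold>\<exists>n. \<^bold>\<exists>xs. \<^bold>\<exists>y.
          x \<^bold>= jval (pr_proj (\<^bold>S i)) (cons n xs) y \<^bold>\<and> X (jval (pr_proj i) xs y)) \<^bold>\<or>
       (\<^bold>\<exists>f. \<^bold>\<exists>gs. \<^bold>\<exists>xs. \<^bold>\<exists>ys. \<^bold>\<exists>z.
          x \<^bold>= jval (pr_comp f gs) xs z \<^bold>\<and> X (jvals gs xs ys) \<^bold>\<and> X (jval f ys z)) \<^bold>\<or>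
       (\<^bold>\<exists>f. \<^bold>\<exists>g. \<^bold>\<exists>xs. \<^bold>\<exists>y.
          x \<^bold>= jval (pr_rec f g) (cons (num 0) xs) y \<^bold>\<and> X (jval f xs y)) \<^bold>\<or>
       (\<^bold>\<exists>f. \<^bold>\<exists>g. \<^bold>\<exists>n. \<^bold>\<exists>xs. \<^bold>\<exists>y. \<^bold>\<exists>z.
          x \<^bold>= jval (pr_rec f g) (cons (\<^bold>S n) xs) z \<^bold>\<and>
          X (jval (pr_rec f g) (cons n xs) y) \<^bold>\<and> X (jval g (cons n (cons y xs)) z)) \<^bold>\<or>
       (\<^bold>\<exists>xs. x \<^bold>= jvals (num 0) xs (num 0)) \<^bold>\<or>
       (\<^bold>\<exists>g. \<^bold>\<exists>gs. \<^bold>\<exists>xs. \<^bold>\<exists>y. \<^bold>\<exists>ys.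
          x \<^bold>= jvals (cons g gs) xs (cons y ys) \<^bold>\<and> X (jval g xs y) \<^bold>\<and> X (jvals gs xs ys)))
     (val_step Y x')"
    unfolding val_step_def using \<open>pden b ys X Y\<close> \<open>den b ys x x'\<close>
    by - (assumption | rule denI | rule mono_rules)+
qed (assumption | rule denI)+

lemma mono_val_step: "mono val_step"
  unfolding val_step_def
  by (rule monoI, rule predicate1I)
    (erule disj_forward ex_forward conj_forward | assumption | erule (1) predicate1D)+

lemmas val_step_defs = val_step_def njval_def njvals_def npr_proj_def npr_comp_def npr_rec_def

lemma nval_zero: "nval npr_zero xs 0"
  unfolding nval_def by (rule Derivable_axiom[OF mono_val_step]) (simp add: val_step_defs)

lemma nval_succ: "nval npr_succ (ncons n 0) (n + 1)"
  unfolding nval_def by (rule Derivable_axiom[OF mono_val_step]) (simp add: val_step_defs)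

lemma nval_proj_0: "nval (npr_proj 0) (ncons n xs) n"
  unfolding nval_def by (rule Derivable_axiom[OF mono_val_step]) (simp add: val_step_defs)

lemma nval_proj_succ: "nval (npr_proj i) xs y \<Longrightarrow> nval (npr_proj (i + 1)) (ncons n xs) y"
  unfolding nval_def
  by (erule Derivable_rule1[OF mono_val_step]) (simp_all add: val_step_defs)

lemma nval_comp: "nvals gs xs ys \<Longrightarrow> nval f ys z \<Longrightarrow> nval (npr_comp f gs) xs z"
  unfolding nval_def nvals_def
  by (erule (1) Derivable_rule[OF mono_val_step]) (simp_all add: val_step_defs)

lemma nval_rec_0: "nval f xs y \<Longrightarrow> nval (npr_rec f g) (ncons 0 xs) y"
  unfolding nval_def
  by (erule Derivable_rule1[OF mono_val_step]) (simp_all add: val_step_defs)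

lemma nval_rec_succ:
  "nval (npr_rec f g) (ncons n xs) y \<Longrightarrow> nval g (ncons n (ncons y xs)) z \<Longrightarrow>
    nval (npr_rec f g) (ncons (n + 1) xs) z"
  unfolding nval_def
  by (erule (1) Derivable_rule[OF mono_val_step]) (simp add: val_step_defs, blast)

lemma nvals_Nil: "nvals 0 xs 0"
  unfolding nvals_def by (rule Derivable_axiom[OF mono_val_step]) (simp add: val_step_defs)

lemma nvals_Cons: "nval g xs y \<Longrightarrow> nvals gs xs ys \<Longrightarrow> nvals (ncons g gs) xs (ncons y ys)"
  unfolding nval_def nvals_def
  by (erule (1) Derivable_rule[OF mono_val_step]) (simp_all add: val_step_defs)

section \<open>Programs for arithmetic, pairing and monomials\<close>

definition comp1 :: "'m::pa_model \<Rightarrow> 'm \<Rightarrow> 'm" where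
  "comp1 f g = npr_comp f (ncons g 0)"

definition comp2 :: "'m::pa_model \<Rightarrow> 'm \<Rightarrow> 'm \<Rightarrow> 'm" where
  "comp2 f g h = npr_comp f (ncons g (ncons h 0))"

lemma nfun_comp1: "nfun 1 f \<Longrightarrow> nfun n g \<Longrightarrow> nfun n (comp1 f g)"
  unfolding comp1_def using nfuns_Cons[OF _ nfuns_Nil, of n g] by (auto intro: nfun_comp)

lemma nfun_comp2: "nfun 2 f \<Longrightarrow> nfun n g \<Longrightarrow> nfun n h \<Longrightarrow> nfun n (comp2 f g h)"
  unfolding comp2_def using nfuns_Cons[OF _ nfuns_Cons[OF _ nfuns_Nil], of n g h] by (auto intro: nfun_comp)

lemma nfun_rec1: "nfun 0 f \<Longrightarrow> nfun 2 g \<Longrightarrow> nfun 1 (npr_rec f g)"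
  using nfun_rec[of 0 f g] by simp

lemma nfun_rec2: "nfun 1 f \<Longrightarrow> nfun 3 g \<Longrightarrow> nfun 2 (npr_rec f g)"
  using nfun_rec[of 1 f g] by simp

lemma nval_comp1: "nval g xs y \<Longrightarrow> nval f (ncons y 0) z \<Longrightarrow> nval (comp1 f g) xs z"
  unfolding comp1_def by (assumption | rule nval_comp nvals_Cons nvals_Nil)+

lemma nval_comp2:
  "nval g xs y \<Longrightarrow> nval h xs y' \<Longrightarrow> nval f (ncons y (ncons y' 0)) z \<Longrightarrow> nval (comp2 f g h) xs z"
  unfolding comp2_def by (assumption | rule nval_comp nvals_Cons nvals_Nil)+

lemma nval_proj_1: "nval (npr_proj 1) (ncons x (ncons y xs)) y"
  using nval_proj_succ[OF nval_proj_0] by simp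

lemma nval_proj_2: "nval (npr_proj 2) (ncons x (ncons y (ncons z xs))) z"
  using nval_proj_succ[OF nval_proj_1] by simp

lemmas nfun_intros = nfun_zero nfun_succ nfun_proj nfun_comp1 nfun_comp2 nfun_rec1 nfun_rec2
lemmas nval_intros = nval_zero nval_succ nval_proj_0 nval_proj_1 nval_proj_2 nval_comp1 nval_comp2

text \<open>Recursion also serves as a case distinction on its first argument, with the previous
  value discarded. The evaluation rule still demands that this value exists, which totality
  provides.\<close>

lemma nval_rec_ex:
  assumes f: "\<exists>y. nval f xs y" and g: "\<And>n y. \<exists>z. nval g (ncons n (ncons y xs)) z"
  shows "\<exists>y. nval (npr_rec f g) (ncons n xs) y"
proof (rule pa_induct[of "\<lambda>n. \<exists>y. nval (npr_rec f g) (ncons n xs) y"])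
  show "definable (\<lambda>n. \<exists>y. nval (npr_rec f g) (ncons n xs) y)"
    by (rule definableI) (assumption | rule denI | rule mono_rules | rule den_element)+
qed (use f g nval_rec_0 nval_rec_succ in blast)+

definition add_code :: "'m::pa_model" where
  "add_code = npr_rec (npr_proj 0) (comp1 npr_succ (npr_proj 1))"

definition mult_code :: "'m::pa_model" where
  "mult_code = npr_rec npr_zero (comp2 add_code (npr_proj 1) (npr_proj 2))"

definition pair_code :: "'m::pa_model" where
  "pair_code = comp2 add_code (comp2 mult_code add_code add_code) (npr_proj 0)"

text \<open>The inner \<open>pair_code\<close> acts on the argument list \<open>a, k\<close> as it
  stands. Pairing with 0 and adding 1 makes its value a list with one entry.\<close>

definition monomial_code :: "'m::pa_model" where
  "monomial_code = comp1 npr_succ (comp2 pair_code pair_code npr_zero)"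

definition one_code :: "'m::pa_model" where
  "one_code = comp1 npr_succ npr_zero"

lemma nfun_add: "nfun 2 add_code"
  unfolding add_code_def by (intro nfun_intros) simp_all

lemma nfun_mult: "nfun 2 mult_code"
  unfolding mult_code_def by (intro nfun_intros nfun_add) simp_all

lemma nfun_pair: "nfun 2 pair_code"
  unfolding pair_code_def by (intro nfun_intros nfun_add nfun_mult) simp_all

lemma nfun_monomial: "nfun 2 monomial_code"
  unfolding monomial_code_def by (intro nfun_intros nfun_pair)

lemma nfun_one: "nfun n one_code"
  unfolding one_code_def by (intro nfun_intros)

lemma nval_add: "nval add_code (ncons x (ncons y 0)) (x + y)"
proof (rule pa_induct[of "\<lambda>x. nval add_code (ncons x (ncons y 0)) (x + y)"])
  show "definable (\<lambda>x. nval add_code (ncons x (ncons y 0)) (x + y))"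
    by (rule definableI) (assumption | rule denI | rule mono_rules | rule den_element)+
  show "nval add_code (ncons 0 (ncons y 0)) (0 + y)"
    unfolding add_code_def by (simp add: nval_rec_0 nval_proj_0)
  show "nval add_code (ncons (x + 1) (ncons y 0)) (x + 1 + y)"
    if "nval add_code (ncons x (ncons y 0)) (x + y)" for x
  proof -
    have "x + 1 + y = x + y + 1" by (simp add: ac_simps)
    with that show ?thesis
      unfolding add_code_def by (auto intro: nval_rec_succ nval_intros)
  qed
qed

lemma nval_mult: "nval mult_code (ncons x (ncons y 0)) (x * y)"
proof (rule pa_induct[of "\<lambda>x. nval mult_code (ncons x (ncons y 0)) (x * y)"])
  show "definable (\<lambda>x. nval mult_code (ncons x (ncons y 0)) (x * y))"
    by (rule definableI) (assumption | rule denI | rule mono_rules | rule den_element)+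
  show "nval mult_code (ncons 0 (ncons y 0)) (0 * y)"
    unfolding mult_code_def by (simp add: nval_rec_0 nval_zero)
  show "nval mult_code (ncons (x + 1) (ncons y 0)) ((x + 1) * y)"
    if "nval mult_code (ncons x (ncons y 0)) (x * y)" for x
  proof -
    have "(x + 1) * y = x * y + y" by (simp add: algebra_simps)
    with that show ?thesis
      unfolding mult_code_def by (auto intro: nval_rec_succ nval_intros nval_add)
  qed
qed

lemma nval_pair: "nval pair_code (ncons x (ncons y 0)) (npair x y)"
  unfolding pair_code_def npair_def by (rule nval_intros nval_add nval_mult)+

lemma nval_monomial: "nval monomial_code (ncons a (ncons k 0)) (nocons a k 0)"
  unfolding monomial_code_def nocons_def ncons_def[of "npair a k"]
  by (rule nval_intros nval_pair)+

lemma nval_one: "nval one_code xs 1"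
  unfolding one_code_def using nval_comp1[OF nval_zero nval_succ] by simp

text \<open>The constant may be nonstandard. Its program composes the successor with itself
  \<open>w\<close> times, and such a code exists by induction in the model.\<close>

lemma constant_code: "\<exists>f. (\<forall>n. nfun n f) \<and> (\<forall>xs. nval f xs w)"
proof (rule pa_induct[of "\<lambda>w. \<exists>f. (\<forall>n. nfun n f) \<and> (\<forall>xs. nval f xs w)"])
  show "definable (\<lambda>w. \<exists>f. (\<forall>n. nfun n f) \<and> (\<forall>xs. nval f xs w))"
    by (rule definableI) (assumption | rule denI | rule mono_rules | rule den_element)+
  show "\<exists>f. (\<forall>n. nfun n f) \<and> (\<forall>xs. nval f xs 0)"
    using nfun_zero nval_zero by blast
  show "\<exists>f. (\<forall>n. nfun n f) \<and> (\<forall>xs. nval f xs (w + 1))"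
    if "\<exists>f. (\<forall>n. nfun n f) \<and> (\<forall>xs. nval f xs w)" for w
    using that nfun_comp1[OF nfun_succ] nval_comp1[OF _ nval_succ] by blast
qed


section \<open>Slowing down\<close>

definition ndescending :: "'m::pa_model \<Rightarrow> bool" where
  "ndescending e \<longleftrightarrow> nfun 1 e \<and> (\<forall>i. \<exists>a b. nval e (ncons i 0) a \<and> nval e (ncons (i + 1) 0) b \<and>
     nord a \<and> nord b \<and> noless b a)"

definition nslow :: "'m::pa_model \<Rightarrow> bool" where
  "nslow e \<longleftrightarrow> (\<exists>K. \<forall>i. \<exists>a l. nval e (ncons i 0) a \<and> (\<exists>m. nlen_max a m \<and> l = m + 1) \<and>
     l \<le> K * (i + 1))"

definition nko_bounded :: "'m::pa_model \<Rightarrow> bool" where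
  "nko_bounded e \<longleftrightarrow> (\<forall>r. \<exists>b m. nval e (ncons r 0) b \<and> nko b m \<and> m \<le> r + 1)"

lemma fden_pr_descending [denI]: "den b xs s x \<Longrightarrow> fden b xs (pr_descending s) (ndescending x)"
  unfolding pr_descending_def ndescending_def nth_val_def
  by (assumption | rule denI | rule mono_rules)+

lemma fden_slow [denI]: "den b xs s x \<Longrightarrow> fden b xs (slow s) (nslow x)"
  unfolding slow_def nslow_def nth_val_def is_olen_def
  by (assumption | rule denI | rule mono_rules)+

lemma fden_ko_bounded [denI]: "den b xs s x \<Longrightarrow> fden b xs (ko_bounded s) (nko_bounded x)"
  unfolding ko_bounded_def nko_bounded_def nth_val_def
  by (assumption | rule denI | rule mono_rules)+

text \<open>From a < w follows omega^a * k + b < omega^w, so every exponent on the leading path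
  costs one more level of the tower, starting from omega^0. The last clause, w < omega^w, is carried
  along because the filler sequence descends by it.\<close>

lemma tower_above:
  assumes "nord u"
  shows "\<exists>w. noless u w \<and> nord w \<and> nko w 1 \<and> noless w (nocons w 1 0)"
  using assms
proof (induction rule: nord_induct)
  case definable
  show ?case by (rule definableI) (assumption | rule denI | rule mono_rules | rule den_element)+
next
  case zero
  have "nko (nocons 0 1 0) (max 0 1)" by (intro nko_monomial nko_0)
  then show ?case
    by (intro exI[of _ "nocons 0 1 0"])
      (simp add: noless_0 noless_exponent nord_monomial nord_0 zero_less_one max_def)
next
  case (exponent a k b)
  then obtain w where w: "noless a w" "nord w" "nko w 1" "noless w (nocons w 1 0)" by blast
  have "nko (nocons w 1 0) (max 1 1)" by (intro nko_monomial w)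
  with w show ?case
    by (intro exI[of _ "nocons w 1 0"]) (simp add: noless_exponent nord_monomial zero_less_one)
qed

theorem slowing_down:
  fixes e :: "'m::pa_model"
  assumes desc: "ndescending e" and slow: "nslow e"
  shows "\<exists>f. ndescending f \<and> nko_bounded (f::'m::pa_model)"
proof -
  have e: "nfun 1 e" using desc unfolding ndescending_def by blast
  have e_desc: "\<exists>a b. nval e (ncons i 0) a \<and> nval e (ncons (i + 1) 0) b \<and>
     nord a \<and> nord b \<and> noless b a" for i
    using desc unfolding ndescending_def by blast
  obtain K where K: "\<And>i. \<exists>a m. nval e (ncons i 0) a \<and> nlen_max a m \<and> m + 1 \<le> K * (i + 1)"
    using slow unfolding nslow_def by blast
  have "K \<noteq> 0"
  proof
    assume "K = 0"
    then show False using K[of 0] pa_succ_neq_0 by auto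
  qed
  \<comment> \<open>Within a block a counter runs from \<open>L\<close> down to 0. The coefficient
    is the counter plus 1, so a block has exactly \<open>K\<close> members.\<close>
  then obtain L where L: "K = L + 1" using pa_zero_or_succ by blast
  obtain a0 where a0: "nval e (ncons 0 0) a0" "nord a0" using e_desc by blast
  then obtain w0 where w0: "noless a0 w0" "nord w0" "nko w0 1" "noless w0 (nocons w0 1 0)"
    using tower_above by blast
  \<comment> \<open>One level above \<open>w0\<close>: from alpha_0 < w0 follows omega^alpha_0 * K <
    omega^w0. This is the smallest filler, placed just before the first block.\<close>
  define w where "w = nocons w0 1 0"
  have w: "nord w" "nko w 1" "noless w (nocons w 1 0)"
    using nko_monomial[OF w0(3), of 1] w0 unfolding w_def
    by (simp_all add: nord_monomial noless_exponent zero_less_one)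
  obtain W where W: "\<And>n. nfun n W" "\<And>xs. nval W xs w" using constant_code by blast
  obtain M where M: "\<And>n. nfun n M" "\<And>xs. nval M xs L" using constant_code by blast

  \<comment> \<open>At position r, \<open>C\<close> gives the counter and \<open>I\<close> the
    number of the block; the counter returns to \<open>L\<close> after 0, and at that moment the
    block number grows. \<open>T\<close> puts further levels on top of \<open>w\<close>.
    \<open>G\<close> selects by the block number: block 0 consists of the towers T(c), and block n +
    1 of the ordinals omega^alpha_n * (c + 1). The recursions inside \<open>C\<close> and
    \<open>I\<close> test a counter for 0.\<close>
  define T where "T = npr_rec W (comp2 monomial_code (npr_proj 1) one_code)"
  define C where "C = npr_rec M (comp2 (npr_rec (npr_proj 0) (npr_proj 0)) (npr_proj 1) M)"
  define I where "I = npr_rec npr_zero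
    (comp2 (npr_rec npr_succ (npr_proj 2)) (comp1 C (npr_proj 0)) (npr_proj 1))"
  define G where "G = npr_rec T (comp2 monomial_code (comp1 e (npr_proj 0)) (comp1 npr_succ (npr_proj 2)))"
  define f where "f = comp2 G I C"

  have T: "nfun 1 T" unfolding T_def by (intro nfun_intros nfun_monomial nfun_one W) simp
  have C: "nfun 1 C" unfolding C_def by (intro nfun_intros M) simp_all
  have I: "nfun 1 I" unfolding I_def by (intro nfun_intros C) simp_all
  have G: "nfun 2 G" unfolding G_def by (intro nfun_intros nfun_monomial T e) simp_all
  have f: "nfun 1 f" unfolding f_def by (intro nfun_intros G I C)

  have T_0: "nval T (ncons 0 0) w"
    unfolding T_def by (intro nval_rec_0 W)
  have T_succ: "nval T (ncons (c + 1) 0) (nocons v 1 0)" if "nval T (ncons c 0) v" for c v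
    using that unfolding T_def by (rule nval_rec_succ) (rule nval_intros nval_monomial nval_one)+
  have T_ex: "\<exists>v. nval T (ncons c 0) v \<and> nord v \<and> nko v 1 \<and> noless v (nocons v 1 0)" for c
  proof (rule pa_induct[of "\<lambda>c. \<exists>v. nval T (ncons c 0) v \<and> nord v \<and> nko v 1 \<and> noless v (nocons v 1 0)"])
    show "definable (\<lambda>c. \<exists>v. nval T (ncons c 0) v \<and> nord v \<and> nko v 1 \<and> noless v (nocons v 1 0))"
      by (rule definableI) (assumption | rule denI | rule mono_rules | rule den_element)+
    show "\<exists>v. nval T (ncons 0 0) v \<and> nord v \<and> nko v 1 \<and> noless v (nocons v 1 0)"
      using T_0 w by blast
    fix c
    assume "\<exists>v. nval T (ncons c 0) v \<and> nord v \<and> nko v 1 \<and> noless v (nocons v 1 0)"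
    then obtain v where v: "nval T (ncons c 0) v" "nord v" "nko v 1" "noless v (nocons v 1 0)" by blast
    then show "\<exists>v. nval T (ncons (c + 1) 0) v \<and> nord v \<and> nko v 1 \<and> noless v (nocons v 1 0)"
      using T_succ[OF v(1)] nko_monomial[OF v(3), of 1]
      by (intro exI[of _ "nocons v 1 0"]) (simp add: nord_monomial noless_exponent zero_less_one)
  qed

  have C_0: "nval C (ncons 0 0) L"
    unfolding C_def by (intro nval_rec_0 M)
  have C_reset: "nval C (ncons (r + 1) 0) L" if "nval C (ncons r 0) 0" for r
    using that unfolding C_def by (rule nval_rec_succ) (rule nval_intros nval_rec_0 M)+
  have C_dec: "nval C (ncons (r + 1) 0) c" if r: "nval C (ncons r 0) (c + 1)" for r c
  proof -
    obtain y where "nval (npr_rec (npr_proj 0) (npr_proj 0)) (ncons c (ncons L 0)) y"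
      using nval_rec_ex nval_proj_0 by metis
    then have "nval (npr_rec (npr_proj 0) (npr_proj 0)) (ncons (c + 1) (ncons L 0)) c"
      by (rule nval_rec_succ) (rule nval_proj_0)
    then show ?thesis
      using r unfolding C_def by - (rule nval_rec_succ, assumption, (assumption | rule nval_intros M)+)
  qed
  have I_0: "nval I (ncons 0 0) 0"
    unfolding I_def by (intro nval_rec_0 nval_zero)
  have I_inc: "nval I (ncons (r + 1) 0) (i + 1)"
    if i: "nval I (ncons r 0) i" and c: "nval C (ncons r 0) 0" for r i
    using i unfolding I_def by (rule nval_rec_succ) (rule nval_intros nval_rec_0 c)+
  have I_const: "nval I (ncons (r + 1) 0) i"
    if i: "nval I (ncons r 0) i" and c: "nval C (ncons r 0) (c + 1)" for r i c
  proof -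
    have "\<exists>z. nval npr_succ (ncons i 0) z" "\<exists>z. nval (npr_proj 2) (ncons n (ncons y (ncons i 0))) z" for n y
      using nval_succ nval_proj_2 by blast+
    then obtain y where "nval (npr_rec npr_succ (npr_proj 2)) (ncons c (ncons i 0)) y"
      using nval_rec_ex by metis
    then have "nval (npr_rec npr_succ (npr_proj 2)) (ncons (c + 1) (ncons i 0)) i"
      by (rule nval_rec_succ) (rule nval_proj_2)
    then show ?thesis
      using i unfolding I_def
      by - (rule nval_rec_succ, assumption, (assumption | rule nval_intros c)+)
  qed

  have G_0: "nval G (ncons 0 (ncons c 0)) v" if "nval T (ncons c 0) v" for c v
    unfolding G_def by (intro nval_rec_0 that)
  have G_step: "nval (comp2 monomial_code (comp1 e (npr_proj 0)) (comp1 npr_succ (npr_proj 2)))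
      (ncons n (ncons y (ncons c 0))) (nocons a (c + 1) 0)" if "nval e (ncons n 0) a" for n y c a
    by (rule nval_intros nval_monomial that)+
  have G_succ: "nval G (ncons (n + 1) (ncons c 0)) (nocons a (c + 1) 0)" if a: "nval e (ncons n 0) a" for n c a
  proof -
    obtain y where "nval G (ncons n (ncons c 0)) y"
      using nval_rec_ex[of T "ncons c 0"] T_ex G_step e_desc unfolding G_def by meson
    then show ?thesis
      unfolding G_def by (rule nval_rec_succ) (rule G_step[OF a])
  qed
  have f_val: "nval f (ncons r 0) z"
    if "nval I (ncons r 0) i" "nval C (ncons r 0) c" "nval G (ncons i (ncons c 0)) z" for r i c z
    unfolding f_def by (rule nval_comp2 that)+

  \<comment> \<open>Block i starts at K * i, and r lies L - c positions further. The equation states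
    this without subtraction.\<close>
  have state: "\<exists>i c. nval I (ncons r 0) i \<and> nval C (ncons r 0) c \<and> c \<le> L \<and> r + c = K * i + L" for r
  proof (rule pa_induct[of "\<lambda>r. \<exists>i c. nval I (ncons r 0) i \<and> nval C (ncons r 0) c \<and> c \<le> L \<and> r + c = K * i + L"])
    show "definable (\<lambda>r. \<exists>i c. nval I (ncons r 0) i \<and> nval C (ncons r 0) c \<and> c \<le> L \<and> r + c = K * i + L)"
      by (rule definableI) (assumption | rule denI | rule mono_rules | rule den_element)+
    show "\<exists>i c. nval I (ncons 0 0) i \<and> nval C (ncons 0 0) c \<and> c \<le> L \<and> 0 + c = K * i + L"
      using I_0 C_0 by (intro exI[of _ 0] exI[of _ L]) simp
    fix r
    assume "\<exists>i c. nval I (ncons r 0) i \<and> nval C (ncons r 0) c \<and> c \<le> L \<and> r + c = K * i + L"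
    then obtain i c where i: "nval I (ncons r 0) i" and c: "nval C (ncons r 0) c"
      and "c \<le> L" and r: "r + c = K * i + L" by blast
    show "\<exists>i c. nval I (ncons (r + 1) 0) i \<and> nval C (ncons (r + 1) 0) c \<and> c \<le> L \<and> r + 1 + c = K * i + L"
    proof (cases "c = 0")
      case True
      have "r + 1 + L = K * (i + 1) + L" using r unfolding True L by (simp add: algebra_simps)
      moreover have "nval I (ncons (r + 1) 0) (i + 1)" "nval C (ncons (r + 1) 0) L"
        using I_inc C_reset i c unfolding True by blast+
      ultimately show ?thesis by blast
    next
      case False
      then obtain c' where c': "c = c' + 1" using pa_zero_or_succ by blast
      have "nval I (ncons (r + 1) 0) i" "nval C (ncons (r + 1) 0) c'"
        using I_const C_dec i c unfolding c' by blast+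
      moreover have "r + 1 + c' = K * i + L" using r unfolding c' by (simp add: ac_simps)
      moreover have "c' \<le> L" using \<open>c \<le> L\<close> unfolding c' by (simp add: succ_le_iff)
      ultimately show ?thesis by blast
    qed
  qed

  have "ndescending f"
    unfolding ndescending_def
  proof (intro conjI allI f)
    fix r
    obtain i c where i: "nval I (ncons r 0) i" and c: "nval C (ncons r 0) c" using state by blast
    show "\<exists>a b. nval f (ncons r 0) a \<and> nval f (ncons (r + 1) 0) b \<and> nord a \<and> nord b \<and> noless b a"
    \<comment> \<open>A counter 0 marks the last member of a block. The next coefficient jumps up to
      K, and the descent is due to the leading exponent. Otherwise the block continues: a tower
      loses its outermost level, or a coefficient drops by 1.\<close>
    proof (cases "c = 0")
      case True
      have i': "nval I (ncons (r + 1) 0) (i + 1)" and c': "nval C (ncons (r + 1) 0) L"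
        using I_inc C_reset i c unfolding True by blast+
      show ?thesis
      proof (cases "i = 0")
        case i0: True
        have "nval f (ncons r 0) w"
          using f_val[OF i c] G_0 T_0 unfolding i0 True by blast
        moreover have "nval f (ncons (r + 1) 0) (nocons a0 (L + 1) 0)"
          using f_val[OF i' c'] G_succ a0(1) unfolding i0 by blast
        moreover have "noless (nocons a0 (L + 1) 0) w" unfolding w_def by (rule noless_exponent) (rule w0)
        ultimately show ?thesis using w(1) a0(2) nord_monomial[of a0 "L + 1"] by (auto simp: less_succ_iff)
      next
        case False
        then obtain n where n: "i = n + 1" using pa_zero_or_succ by blast
        obtain a b where ab: "nval e (ncons n 0) a" "nval e (ncons (n + 1) 0) b"
          "nord a" "nord b" "noless b a" using e_desc by blast
        have "nval f (ncons r 0) (nocons a (c + 1) 0)"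
          using f_val[OF i c] G_succ[OF ab(1)] unfolding n by blast
        moreover have "nval f (ncons (r + 1) 0) (nocons b (L + 1) 0)"
          using f_val[OF i' c'] G_succ[OF ab(2)] unfolding n by blast
        moreover have "noless (nocons b (L + 1) 0) (nocons a (c + 1) 0)" using ab(5) by (rule noless_exponent)
        ultimately show ?thesis
          using ab(3,4) nord_monomial[of a "c + 1"] nord_monomial[of b "L + 1"]
          by (auto simp: less_succ_iff)
      qed
    next
      case False
      then obtain c' where c': "c = c' + 1" using pa_zero_or_succ by blast
      have i1: "nval I (ncons (r + 1) 0) i" and c1: "nval C (ncons (r + 1) 0) c'"
        using I_const C_dec i c unfolding c' by blast+
      show ?thesis
      proof (cases "i = 0")
        case True
        obtain v where v: "nval T (ncons c' 0) v" "nord v" "noless v (nocons v 1 0)" using T_ex by blast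
        have "nval f (ncons r 0) (nocons v 1 0)"
          using f_val[OF i c] G_0 T_succ[OF v(1)] unfolding True c' by blast
        moreover have "nval f (ncons (r + 1) 0) v"
          using f_val[OF i1 c1] G_0 v(1) unfolding True by blast
        ultimately show ?thesis using v(2,3) nord_monomial[of v 1] zero_less_one by blast
      next
        case False
        then obtain n where n: "i = n + 1" using pa_zero_or_succ by blast
        obtain a where a: "nval e (ncons n 0) a" "nord a" using e_desc by blast
        have "nval f (ncons r 0) (nocons a (c + 1) 0)"
          using f_val[OF i c] G_succ[OF a(1)] unfolding n by blast
        moreover have "nval f (ncons (r + 1) 0) (nocons a (c' + 1) 0)"
          using f_val[OF i1 c1] G_succ[OF a(1)] unfolding n by blast
        moreover have "noless (nocons a (c' + 1) 0) (nocons a (c + 1) 0)"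
          unfolding c' by (rule noless_coefficient) (simp add: less_succ_iff)
        ultimately show ?thesis
          using a(2) nord_monomial[of a "c + 1"] nord_monomial[of a "c' + 1"]
          by (auto simp: less_succ_iff)
      qed
    qed
  qed
  moreover have "nko_bounded f"
    unfolding nko_bounded_def
  proof
    fix r
    obtain i c where i: "nval I (ncons r 0) i" and c: "nval C (ncons r 0) c"
      and "c \<le> L" and r: "r + c = K * i + L" using state by blast
    show "\<exists>b m. nval f (ncons r 0) b \<and> nko b m \<and> m \<le> r + 1"
    proof (cases "i = 0")
      case True
      obtain v where v: "nval T (ncons c 0) v" "nko v 1" using T_ex by blast
      have "nval f (ncons r 0) v" using f_val[OF i c] G_0 v(1) unfolding True by blast
      \<comment> \<open>At r = 0 this is an equality, so the first filler leaves no room for a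
        coefficient above 1.\<close>
      moreover have "1 \<le> r + 1" by (simp add: add_increasing)
      ultimately show ?thesis using v(2) by blast
    next
      case False
      then obtain n where n: "i = n + 1" using pa_zero_or_succ by blast
      obtain a m where a: "nval e (ncons n 0) a" "nlen_max a m" "m + 1 \<le> K * (n + 1)" using K by blast
      obtain p where p: "p \<le> m" "nko a p" using nlen_max_nko[OF a(2)] by blast
      have "nval f (ncons r 0) (nocons a (c + 1) 0)"
        using f_val[OF i c] G_succ[OF a(1)] unfolding n by blast
      moreover have "nko (nocons a (c + 1) 0) (max p (c + 1))" using p(2) by (rule nko_monomial)
      moreover have "max p (c + 1) \<le> r + 1"
      proof -
        \<comment> \<open>Block n + 1 has started, so K * (n + 1) is at most r. It exceeds the
          coefficients of alpha_n by slowness, and it is at least K, which bounds the new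
          coefficient c + 1.\<close>
        have "K * (n + 1) + c \<le> r + c" using r \<open>c \<le> L\<close> unfolding n by simp
        then have K_r: "K * (n + 1) \<le> r" by simp
        have "p < m + 1" using p(1) by (simp add: less_succ_iff)
        then have "p \<le> r" using a(3) K_r by order
        moreover have "c + 1 \<le> K" unfolding L using \<open>c \<le> L\<close> by simp
        moreover have "K * 1 \<le> K * (n + 1)" by (intro mult_left_mono) (simp_all add: add_increasing)
        ultimately have "c + 1 \<le> r" using K_r by simp
        then have "c \<le> r" by (simp add: succ_le_iff)
        then show ?thesis using \<open>p \<le> r\<close> by (auto intro: add_increasing2)
      qed
      ultimately show ?thesis by blast
    qed
  qed
  ultimately show ?thesis by blast
qed


section \<open>Transfer to PA\<close>

definition slowing_down_sentence :: fm where
  "slowing_down_sentence = closed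
    (\<^bold>\<forall>e. pr_descending e \<^bold>\<and> slow e \<^bold>\<longrightarrow> (\<^bold>\<exists>f. pr_descending f \<^bold>\<and> ko_bounded f))"

lemma holds_slowing_down_sentence:
  "holds b slowing_down_sentence" for b :: "nat \<Rightarrow> 'm::pa_model"
proof -
  have "fden b [] (\<^bold>\<forall>e. pr_descending e \<^bold>\<and> slow e \<^bold>\<longrightarrow> (\<^bold>\<exists>f. pr_descending f \<^bold>\<and> ko_bounded f))
    (\<forall>e::'m. ndescending e \<and> nslow e \<longrightarrow> (\<exists>f::'m. ndescending f \<and> nko_bounded f))"
    by (assumption | rule denI | rule mono_rules)+
  then have "holds b slowing_down_sentence \<longleftrightarrow>
      (\<forall>e::'m. ndescending e \<and> nslow e \<longrightarrow> (\<exists>f::'m. ndescending f \<and> nko_bounded f))"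
    unfolding fden_def slowing_down_sentence_def closed_def
    by (elim allE[of _ "[]"]) (simp only: append_Nil env_Nil list.size)
  then show ?thesis using slowing_down by blast
qed

text \<open>The default model for the case that the sentence is provable, so that a choice is
  possible in either case.\<close>

lemma standard_model: "A \<in> PA \<Longrightarrow> sat 0 Suc (+) (*) \<rho> A"
proof (induction rule: PA.induct)
  case (induction A)
  have env: "(\<lambda>n. tval 0 Suc (+) (*) (case_nat x \<rho>) (case_nat (Succ (Var 0)) (\<lambda>n. Var (Suc n)) n)) =
      case_nat (Suc x) \<rho>" for x
    by (rule ext) (auto split: nat.split)
  show ?case
  proof (simp only: sat.simps sat_inst sat_sub env tval.simps, intro impI allI)
    fix x
    assume "sat 0 Suc (+) (*) (case_nat 0 \<rho>) A"
      "\<forall>x. sat 0 Suc (+) (*) (case_nat x \<rho>) A \<longrightarrow> sat 0 Suc (+) (*) (case_nat (Suc x) \<rho>) A"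
    then show "sat 0 Suc (+) (*) (case_nat x \<rho>) A" by (induction x) simp_all
  qed
qed simp_all

text \<open>Transfers truth between the chosen structure on \<open>nat\<close> and its copy as a
  type with algebraic operations.\<close>

lemma sat_iso:
  assumes h: "surj h" "inj h" and ops: "h z = z'" "\<And>x. h (s x) = s' (h x)"
    "\<And>x y. h (a x y) = a' (h x) (h y)" "\<And>x y. h (m x y) = m' (h x) (h y)"
  shows "sat z s a m \<rho> A \<longleftrightarrow> sat z' s' a' m' (\<lambda>n. h (\<rho> n)) A"
proof -
  have tval: "tval z' s' a' m' (\<lambda>n. h (\<rho> n)) t = h (tval z s a m \<rho> t)" for \<rho> t
    by (induction t) (simp_all add: ops)
  show ?thesis
  proof (induction A arbitrary: \<rho>)
    case (Eq t u)
    then show ?case using h(2) by (simp add: tval inj_eq)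
  next
    case (All A)
    have "(\<lambda>n. h (case_nat x \<rho> n)) = case_nat (h x) (\<lambda>n. h (\<rho> n))" for x
      by (rule ext) (simp split: nat.split)
    then show ?case using All h(1) by simp (metis surj_def)
  qed simp_all
qed

text \<open>
  A model of PA that refutes the sentence, provided that there is one. Having it as a type makes
  the theorems about \<^class>\<open>pa_model\<close> applicable.
\<close>

definition refuting :: "nat \<Rightarrow> (nat \<Rightarrow> nat) \<Rightarrow> (nat \<Rightarrow> nat \<Rightarrow> nat) \<Rightarrow> (nat \<Rightarrow> nat \<Rightarrow> nat) \<Rightarrow> bool" where
  "refuting z s a m \<longleftrightarrow> (\<forall>A\<in>PA. \<forall>\<rho>. sat z s a m \<rho> A) \<and>
     (PA \<turnstile> slowing_down_sentence \<or> (\<exists>\<rho>. \<not> sat z s a m \<rho> slowing_down_sentence))"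

lemma refuting_ex: "\<exists>(z, s, a, m) \<in> UNIV. refuting z s a m"
proof (cases "PA \<turnstile> slowing_down_sentence")
  case True
  then have "refuting 0 Suc (+) (*)" unfolding refuting_def using standard_model by blast
  then show ?thesis by auto
next
  case False
  then obtain z s a m e where "\<forall>B\<in>PA. \<forall>\<rho>. sat (z::nat) s a m \<rho> B" "\<not> sat z s a m e slowing_down_sentence"
    using PA_countermodel by blast
  then have "refuting z s a m" unfolding refuting_def by blast
  then show ?thesis by auto
qed

definition refuter :: "nat \<times> (nat \<Rightarrow> nat) \<times> (nat \<Rightarrow> nat \<Rightarrow> nat) \<times> (nat \<Rightarrow> nat \<Rightarrow> nat)" where
  "refuter = (SOME (z, s, a, m). refuting z s a m)"

text \<open>A copy of \<open>nat\<close> with operations of its own, as \<open>nat\<close> already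
  carries the standard ones.\<close>

datatype element = Element (index: nat)

instance element :: countable by countable_datatype

instantiation element :: "{zero, one, plus, minus, times, ord}"
begin

definition "0 = Element (fst refuter)"
definition "1 = Element (fst (snd refuter) (fst refuter))"
definition "x + y = Element (fst (snd (snd refuter)) (index x) (index y))"
definition "x * y = Element (snd (snd (snd refuter)) (index x) (index y))"
definition "x \<le> y \<longleftrightarrow> (\<exists>z::element. x + z = y)"
definition "x < y \<longleftrightarrow> (\<exists>z::element. x + 1 + z = y)"
definition "x - y = (if y \<le> x then THE z::element. y + z = x else 0)"

instance ..

end

abbreviation refuter_sat :: "(nat \<Rightarrow> nat) \<Rightarrow> fm \<Rightarrow> bool" where
  "refuter_sat \<equiv>
    sat (fst refuter) (fst (snd refuter)) (fst (snd (snd refuter))) (snd (snd (snd refuter)))"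

lemma holds_element:
  "holds \<rho> A \<longleftrightarrow> refuter_sat (\<lambda>n. index (\<rho> n)) A"
  and refuter_PA: "A \<in> PA \<Longrightarrow> refuter_sat \<rho>' A"
  and refuter_sentence: "\<not> PA \<turnstile> slowing_down_sentence \<Longrightarrow> \<exists>\<rho>. \<not> refuter_sat \<rho> slowing_down_sentence"
proof -
  obtain z s a m where r: "refuter = (z, s, a, m)" by (cases refuter)
  have "refuting z s a m"
    using someI_ex[of "\<lambda>(z, s, a, m). refuting z s a m"] refuting_ex r unfolding refuter_def by auto
  then have PA: "\<And>A \<rho>. A \<in> PA \<Longrightarrow> sat z s a m \<rho> A" and
    sentence: "\<not> PA \<turnstile> slowing_down_sentence \<Longrightarrow> \<exists>\<rho>. \<not> sat z s a m \<rho> slowing_down_sentence"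
    unfolding refuting_def by blast+
  from PA show "A \<in> PA \<Longrightarrow> refuter_sat \<rho>' A" by (simp add: r)
  from sentence show "\<not> PA \<turnstile> slowing_down_sentence \<Longrightarrow> \<exists>\<rho>. \<not> refuter_sat \<rho> slowing_down_sentence"
    by (simp add: r)
  \<comment> \<open>The successor of the structure is addition of 1 by the axioms for addition, so
    reading \<open>Succ\<close> as \<open>x + 1\<close> agrees with the chosen structure.\<close>
  have "a x (s z) = s x" for x
    using PA[OF PA.Add_Succ, of "case_nat x (\<lambda>_. z)"] PA[OF PA.Add_Zero, of "\<lambda>_. x"] by simp
  then show "holds \<rho> A \<longleftrightarrow> refuter_sat (\<lambda>n. index (\<rho> n)) A"
    by (intro sat_iso)
      (auto simp: surj_def inj_def r zero_element_def one_element_def plus_element_def times_element_def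
        element.expand intro: exI[of _ "Element _"])
qed

instance element :: pa_model
proof
  show "holds \<rho> A" if "A \<in> PA" for A and \<rho> :: "nat \<Rightarrow> element"
    unfolding holds_element using that by (rule refuter_PA)
qed (rule less_eq_element_def less_element_def minus_element_def)+

theorem theorem3p5:
  shows "PA \<turnstile> closed
    (\<^bold>\<forall>e. pr_descending e \<^bold>\<and> slow e \<^bold>\<longrightarrow> (\<^bold>\<exists>f. pr_descending f \<^bold>\<and> ko_bounded f))"
proof -
  have "PA \<turnstile> slowing_down_sentence"
  proof (rule ccontr)
    assume "\<not> ?thesis"
    then obtain \<rho> where \<rho>: "\<not> refuter_sat \<rho> slowing_down_sentence"
      using refuter_sentence by blast
    have "holds (\<lambda>n. Element (\<rho> n)) slowing_down_sentence"
      by (rule holds_slowing_down_sentence)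
    with \<rho> show False by (simp only: holds_element element.sel)
  qed
  then show ?thesis unfolding slowing_down_sentence_def .
qed

end
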